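(* The variety $\Sigma(5,2,3,8)$ has codimension at least one in $G(3,S_2)$. (Here $N_1=55$, $N_2=54$.)
   Context: For positive integers $n,d,r,s$: let $V$ be a $\mathbb C$-vector space of dimension $n+1$ and $S_d=\mathrm{Sym}^d V$ (degree $d$ forms in $x_0,\dots,x_n$); assume $r\le s\le\dim S_d$. $G(r,S_d)$ is the Grassmannian of $r$-dimensional subspaces of $S_d$. $U_s\subseteq \mathrm{Sym}^s(\mathbb P S_1)$ is the open set of unordered $s$-tuples $\{Q_1,\dots,Q_s\}$ of linear forms (up to scalars) with $Q_1^d,\dots,Q_s^d$ linearly independent over $\mathbb C$. $\Sigma=\Sigma(n,d,r,s)\subseteq G(r,S_d)$ is the (constructible) set of all $\Lambda$ such that $\Lambda\subseteq \mathrm{span}(Q_1^d,\dots,Q_s^d)$ for some $\{Q_1,\dots,Q_s\}\in U_s$. Also $N_1=sn+r(s-r)$ and $N_2=\dim G(r,S_d)=r\left(\binom{n+d}{d}-r\right)$. In the present statement $(n,d,r,s)=(5,2,3,8)$. *)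

theory Defs
  imports
    "HOL-Analysis.Analysis"
    "HOL-Library.Poly_Mapping"
    "HOL-Library.Multiset"
    "Jordan_Normal_Form.Determinant"
begin

section \<open>Polynomials and forms\<close>

type_synonym 'v monom = "'v \<Rightarrow>\<^sub>0 nat"

text \<open>Polynomials over the complex numbers in variables indexed by \<^typ>\<open>'v\<close>; the ring structure
  (in particular the powers \<open>Q ^ d\<close>) is the convolution product of \<^theory>\<open>HOL-Library.Poly_Mapping\<close>.\<close>

type_synonym 'v cpoly = "'v monom \<Rightarrow>\<^sub>0 complex"

definition cscale :: "complex \<Rightarrow> 'v cpoly \<Rightarrow> 'v cpoly" where
  "cscale c p = Poly_Mapping.single 0 c * p"

lemma lookup_cscale: "Poly_Mapping.lookup (cscale c p) m = c * Poly_Mapping.lookup p m"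
proof -
  have "cscale c p = Poly_Mapping.map ((*) c) p"
    by (simp add: cscale_def mult_map_scale_conv_mult)
  then show ?thesis
    by (simp add: Poly_Mapping.map.rep_eq when_def)
qed

global_interpretation cpoly: vector_space "cscale :: complex \<Rightarrow> 'v cpoly \<Rightarrow> 'v cpoly"
  by unfold_locales
    (simp_all add: poly_mapping_eq_iff fun_eq_iff lookup_cscale lookup_add algebra_simps)

definition monomials :: "'v set \<Rightarrow> nat \<Rightarrow> 'v monom set" where
  "monomials X d = {m. Poly_Mapping.keys m \<subseteq> X \<and>
     (\<Sum>x\<in>Poly_Mapping.keys m. Poly_Mapping.lookup m x) = d}"

text \<open>Forms of degree \<open>d\<close> in the variables \<open>X\<close>, including the zero form.\<close>

definition forms :: "'v set \<Rightarrow> nat \<Rightarrow> 'v cpoly set" where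
  "forms X d = {p. Poly_Mapping.keys p \<subseteq> monomials X d}"

definition poly_eval :: "('v \<Rightarrow> complex) \<Rightarrow> 'v cpoly \<Rightarrow> complex" where
  "poly_eval a p = (\<Sum>m\<in>Poly_Mapping.keys p. Poly_Mapping.lookup p m *
     (\<Prod>x\<in>Poly_Mapping.keys m. a x ^ Poly_Mapping.lookup m x))"

text \<open>\<open>Sym_forms n d\<close> is the space \<open>Sym\<^sup>d V\<close> of degree \<open>d\<close> forms in \<open>x\<^sub>0, \<dots>, x\<^sub>n\<close>, where
  \<open>x\<^sub>0, \<dots>, x\<^sub>n\<close> is a basis of \<open>V\<close>.\<close>

definition Sym_forms :: "nat \<Rightarrow> nat \<Rightarrow> nat cpoly set" where
  "Sym_forms n d = forms {0..n} d"

definition lin_indep_list :: "'v cpoly list \<Rightarrow> bool" where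
  "lin_indep_list ps \<longleftrightarrow> distinct ps \<and> cpoly.independent (set ps)"


section \<open>Grassmannians with the Zariski topology\<close>

definition Grass :: "nat \<Rightarrow> 'v cpoly set \<Rightarrow> 'v cpoly set set" where
  "Grass r W = {L. cpoly.subspace L \<and> L \<subseteq> W \<and> cpoly.dim L = r}"

definition basis_list :: "'v cpoly set \<Rightarrow> 'v cpoly list \<Rightarrow> bool" where
  "basis_list L B \<longleftrightarrow> lin_indep_list B \<and> cpoly.span (set B) = L"

text \<open>The Pluecker coordinates of the span of a linearly independent list \<open>B\<close> of length \<open>r\<close>, with
  respect to the monomial basis: they are indexed by \<open>r\<close>-tuples \<open>ms\<close> of monomials, and the
  coordinate is the minor of the coefficient matrix of \<open>B\<close> in the columns \<open>ms\<close>. (Tuples with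
  repetitions give 0 and permuted tuples give the same coordinate up to sign, so allowing all
  tuples does not change the topology below.)\<close>

definition pluecker :: "'v cpoly list \<Rightarrow> 'v monom list \<Rightarrow> complex" where
  "pluecker B ms = Determinant.det (Matrix.mat (length B) (length B)
     (\<lambda>(i, j). Poly_Mapping.lookup (B ! i) (ms ! j)))"

definition pluecker_vars :: "nat \<Rightarrow> nat \<Rightarrow> nat \<Rightarrow> nat monom list set" where
  "pluecker_vars n d r = {ms. length ms = r \<and> set ms \<subseteq> monomials {0..n} d}"

text \<open>The points of \<open>G(r, S\<^sub>d)\<close> where a homogeneous polynomial \<open>F\<close> in the Pluecker coordinates does
  not vanish. A change of basis multiplies all Pluecker coordinates by the same nonzero scalar,
  so for homogeneous \<open>F\<close> the choice of the basis \<open>B\<close> is irrelevant.\<close>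

definition nonvanishing_locus ::
    "nat \<Rightarrow> nat \<Rightarrow> nat \<Rightarrow> nat monom list cpoly \<Rightarrow> nat cpoly set set" where
  "nonvanishing_locus n d r F =
     {L \<in> Grass r (Sym_forms n d). \<exists>B. basis_list L B \<and> poly_eval (pluecker B) F \<noteq> 0}"

text \<open>The Zariski topology on \<open>G(r, S\<^sub>d)\<close>, induced from projective space by the Pluecker embedding.\<close>

definition zariski_Grass :: "nat \<Rightarrow> nat \<Rightarrow> nat \<Rightarrow> nat cpoly set topology" where
  "zariski_Grass n d r = topology_generated_by
     {nonvanishing_locus n d r F | F. \<exists>e. F \<in> forms (pluecker_vars n d r) e}"

lemma topspace_zariski_Grass:
  assumes "r > 0"
  shows "topspace (zariski_Grass n d r) = Grass r (Sym_forms n d)"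
proof
  show "topspace (zariski_Grass n d r) \<subseteq> Grass r (Sym_forms n d)"
    by (auto simp: zariski_Grass_def nonvanishing_locus_def)
  show "Grass r (Sym_forms n d) \<subseteq> topspace (zariski_Grass n d r)"
  proof
    fix L assume L: "L \<in> Grass r (Sym_forms n d)"
    then have sub: "cpoly.subspace L" and dim: "cpoly.dim L = r"
      by (auto simp: Grass_def)
    obtain B where B: "B \<subseteq> L" "cpoly.independent B" "L \<subseteq> cpoly.span B" "card B = cpoly.dim L"
      using cpoly.basis_exists[of L] by metis
    have fin: "finite B"
      using B(4) dim assms card.infinite by force
    obtain bs where bs: "set bs = B" "distinct bs"
      using finite_distinct_list[OF fin] by blast
    have "cpoly.span B \<subseteq> L"
      using B(1) sub by (rule cpoly.span_minimal)
    with bs B have bas: "basis_list L bs"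
      by (auto simp: basis_list_def lin_indep_list_def)
    have one: "(1 :: nat monom list cpoly) \<in> forms (pluecker_vars n d r) 0"
      by (simp add: forms_def monomials_def)
    have "poly_eval (pluecker bs) 1 = 1"
      by (simp add: poly_eval_def)
    with bas L have "L \<in> nonvanishing_locus n d r 1"
      by (force simp: nonvanishing_locus_def)
    with one show "L \<in> topspace (zariski_Grass n d r)"
      unfolding zariski_Grass_def topology_generated_by_topspace by blast
  qed
qed


section \<open>Codimension\<close>

definition irreducible_closed :: "'a topology \<Rightarrow> 'a set \<Rightarrow> bool" where
  "irreducible_closed X Z \<longleftrightarrow> closedin X Z \<and> Z \<noteq> {} \<and>
     (\<forall>A B. closedin X A \<and> closedin X B \<and> Z = A \<union> B \<longrightarrow> Z = A \<or> Z = B)"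

text \<open>For irreducible closed \<open>Z\<close>: the supremum of the lengths \<open>k\<close> of chains
  \<open>Z = C\<^sub>0 \<subset> C\<^sub>1 \<subset> \<dots> \<subset> C\<^sub>k\<close> of irreducible closed sets. For general \<open>Y\<close>: the infimum
  over the irreducible closed subsets of the closure of \<open>Y\<close>.\<close>

definition codim_irreducible :: "'a topology \<Rightarrow> 'a set \<Rightarrow> enat" where
  "codim_irreducible X Z = Sup {enat k | k. \<exists>C :: nat \<Rightarrow> 'a set.
     C 0 = Z \<and> (\<forall>i\<le>k. irreducible_closed X (C i)) \<and> (\<forall>i<k. C i \<subset> C (Suc i))}"

definition codim :: "'a topology \<Rightarrow> 'a set \<Rightarrow> enat" where
  "codim X Y = (INF Z \<in> {Z. irreducible_closed X Z \<and> Z \<subseteq> X closure_of Y}.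
     codim_irreducible X Z)"


section \<open>The sets \<open>U\<^sub>s\<close> and \<open>\<Sigma>\<close>\<close>

text \<open>Points of \<open>\<P>(S\<^sub>1)\<close> are the lines through the origin in \<open>S\<^sub>1\<close>, and unordered \<open>s\<close>-tuples are
  multisets of size \<open>s\<close>. Linear independence of the powers does not depend on the chosen
  representatives and forces them to be nonzero.\<close>

definition U_set :: "nat \<Rightarrow> nat \<Rightarrow> nat \<Rightarrow> nat cpoly set multiset set" where
  "U_set n d s = {mset (map (\<lambda>Q. cpoly.span {Q}) Qs) | Qs.
     length Qs = s \<and> set Qs \<subseteq> Sym_forms n 1 \<and> lin_indep_list (map (\<lambda>Q. Q ^ d) Qs)}"

text \<open>The union below collects the \<open>d\<close>-th powers of all representatives \<open>c Q\<^sub>i\<close> of the points of \<open>M\<close>;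
  since \<open>(c Q\<^sub>i)\<^sup>d = c\<^sup>d Q\<^sub>i\<^sup>d\<close>, they span the same subspace as \<open>Q\<^sub>1\<^sup>d, \<dots>, Q\<^sub>s\<^sup>d\<close>.\<close>

definition power_span :: "nat \<Rightarrow> 'v cpoly set multiset \<Rightarrow> 'v cpoly set" where
  "power_span d M = cpoly.span (\<Union>l\<in>set_mset M. (\<lambda>Q. Q ^ d) ` l)"

definition Sigma_set :: "nat \<Rightarrow> nat \<Rightarrow> nat \<Rightarrow> nat \<Rightarrow> nat cpoly set set" where
  "Sigma_set n d r s = {L \<in> Grass r (Sym_forms n d). \<exists>M \<in> U_set n d s. L \<subseteq> power_span d M}"

text \<open>The natural number subtractions are exact in the range \<open>r \<le> s \<le> dim S\<^sub>d = binomial (n + d) d\<close>.\<close>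

definition N1 :: "nat \<Rightarrow> nat \<Rightarrow> nat \<Rightarrow> nat" where
  "N1 n r s = s * n + r * (s - r)"

definition N2 :: "nat \<Rightarrow> nat \<Rightarrow> nat \<Rightarrow> nat" where
  "N2 n d r = r * (((n + d) choose d) - r)"

end

theory Submission
  imports Defs
begin

text \<open>A net of quadrics \<open>\<langle>A\<^sub>0, A\<^sub>1, A\<^sub>2\<rangle>\<close> in \<open>N = n + 1\<close> variables has a Koszul matrix
  \<open>[0, A\<^sub>2, - A\<^sub>1; - A\<^sub>2, 0, A\<^sub>0; A\<^sub>1, - A\<^sub>0, 0]\<close> of size \<open>3 N\<close>, linear in \<open>(A\<^sub>0, A\<^sub>1, A\<^sub>2)\<close>. A square of a
  linear form contributes rank at most 2, since a cross product with a fixed vector of length 3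
  has rank at most 2. If the net lies in the span of \<open>s\<close> squares with \<open>2 s < 3 N\<close> (here \<open>16 < 18\<close>),
  the determinant therefore vanishes, whereas it is nonzero on some net when \<open>N\<close> is even. Hence
  \<open>\<Sigma>\<close> lies in a proper closed subset of the Grassmannian, which is irreducible because the
  bases of two of its points are joined by a line.\<close>

unbundle no vec_syntax

section \<open>Evaluation of polynomials and homogeneity\<close>

definition monom_eval :: "('v \<Rightarrow> 'a::comm_semiring_1) \<Rightarrow> 'v monom \<Rightarrow> 'a" where
  "monom_eval a m = (\<Prod>x\<in>Poly_Mapping.keys m. a x ^ Poly_Mapping.lookup m x)"

text \<open>Extra variables contribute factors \<open>a x ^ 0 = 1\<close>, so monomials with
  different supports can be compared over one index set.\<close>

lemma monom_eval_superset:
  assumes "finite A" "Poly_Mapping.keys m \<subseteq> A"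
  shows "monom_eval a m = (\<Prod>x\<in>A. a x ^ Poly_Mapping.lookup m x)"
  unfolding monom_eval_def using assms
  by (intro prod.mono_neutral_left) (auto simp: in_keys_iff)

lemma monom_eval_add: "monom_eval a (m + m') = monom_eval a m * monom_eval a m'"
proof -
  let ?A = "Poly_Mapping.keys m \<union> Poly_Mapping.keys m'"
  have "monom_eval a (m + m') = (\<Prod>x\<in>?A. a x ^ Poly_Mapping.lookup (m + m') x)"
    by (rule monom_eval_superset) (use Poly_Mapping.keys_add[of m m'] in auto)
  also have "\<dots> = monom_eval a m * monom_eval a m'"
    by (simp add: monom_eval_superset[of ?A] lookup_add power_add prod.distrib)
  finally show ?thesis .
qed

lemma poly_eval_monom_eval:
  "poly_eval a p = (\<Sum>m\<in>Poly_Mapping.keys p. Poly_Mapping.lookup p m * monom_eval a m)"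
  by (simp add: poly_eval_def monom_eval_def)

lemma poly_eval_superset:
  assumes "finite A" "Poly_Mapping.keys p \<subseteq> A"
  shows "poly_eval a p = (\<Sum>m\<in>A. Poly_Mapping.lookup p m * monom_eval a m)"
  unfolding poly_eval_monom_eval using assms
  by (intro sum.mono_neutral_left) (auto simp: in_keys_iff)

lemma poly_eval_add: "poly_eval a (p + q) = poly_eval a p + poly_eval a q"
proof -
  let ?A = "Poly_Mapping.keys p \<union> Poly_Mapping.keys q"
  have "poly_eval a (p + q) = (\<Sum>m\<in>?A. Poly_Mapping.lookup (p + q) m * monom_eval a m)"
    by (rule poly_eval_superset) (use Poly_Mapping.keys_add[of p q] in auto)
  also have "\<dots> = poly_eval a p + poly_eval a q"
    by (simp add: poly_eval_superset[of ?A] lookup_add distrib_right sum.distrib)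
  finally show ?thesis .
qed

lemma poly_eval_single: "poly_eval a (Poly_Mapping.single m c) = c * monom_eval a m"
  by (simp add: poly_eval_monom_eval)

lemma poly_eval_0: "poly_eval a 0 = 0"
  by (simp add: poly_eval_def)

lemma poly_eval_1: "poly_eval a 1 = 1"
  by (simp add: poly_eval_def)

lemma poly_eval_sum: "poly_eval a (\<Sum>i\<in>I. f i) = (\<Sum>i\<in>I. poly_eval a (f i))"
  by (induction I rule: infinite_finite_induct) (simp_all add: poly_eval_0 poly_eval_add)

lemma poly_mapping_eq_sum_single:
  "p = (\<Sum>m\<in>Poly_Mapping.keys p. Poly_Mapping.single m (Poly_Mapping.lookup p m))"
  by (rule poly_mapping_eqI)
    (simp add: Poly_Mapping.lookup_sum lookup_single when_def in_keys_iff)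

text \<open>Both factors are expanded into single terms, where the claim reduces to
  \<open>monom_eval_add\<close>.\<close>

lemma poly_eval_mult: "poly_eval a (p * q) = poly_eval a p * poly_eval a q"
proof -
  have "p * q = (\<Sum>m\<in>Poly_Mapping.keys p. \<Sum>m'\<in>Poly_Mapping.keys q.
      Poly_Mapping.single (m + m') (Poly_Mapping.lookup p m * Poly_Mapping.lookup q m'))"
    by (subst poly_mapping_eq_sum_single[of p], subst poly_mapping_eq_sum_single[of q])
      (simp add: sum_product mult_single)
  then have "poly_eval a (p * q) = (\<Sum>m\<in>Poly_Mapping.keys p. \<Sum>m'\<in>Poly_Mapping.keys q.
      (Poly_Mapping.lookup p m * monom_eval a m) * (Poly_Mapping.lookup q m' * monom_eval a m'))"
    by (simp add: poly_eval_sum poly_eval_single monom_eval_add mult_ac)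
  then show ?thesis
    by (simp add: poly_eval_monom_eval sum_product)
qed

text \<open>Ring homomorphisms commute with determinants; this is how \<open>koszul_form\<close>
  gets evaluated entry by entry.\<close>

lemma comm_ring_hom_poly_eval: "comm_ring_hom (poly_eval a)"
  by unfold_locales (simp_all add: poly_eval_0 poly_eval_1 poly_eval_add poly_eval_mult)

lemma monom_eval_scale:
  "monom_eval (\<lambda>x. c * a x) m =
    c ^ (\<Sum>x\<in>Poly_Mapping.keys m. Poly_Mapping.lookup m x) * monom_eval a m"
  by (simp add: monom_eval_def power_mult_distrib prod.distrib power_sum)

lemma poly_eval_scale:
  assumes "F \<in> forms X e"
  shows "poly_eval (\<lambda>x. c * a x) F = c ^ e * poly_eval a F"
proof -
  have "monom_eval (\<lambda>x. c * a x) m = c ^ e * monom_eval a m" if "m \<in> Poly_Mapping.keys F" for m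
    using that assms by (auto simp: forms_def monomials_def monom_eval_scale)
  then show ?thesis
    by (simp add: poly_eval_monom_eval sum_distrib_left mult_ac)
qed

text \<open>Scaling the point by 0 multiplies the value by \<open>0 ^ 0 = 1\<close>, so both sides
  equal the value at the origin.\<close>

lemma poly_eval_forms_0:
  assumes "F \<in> forms X 0"
  shows "poly_eval a F = poly_eval b F"
  using poly_eval_scale[OF assms, of 0 a] poly_eval_scale[OF assms, of 0 b] by simp

lemma poly_eval_forms_at_0:
  assumes "F \<in> forms X e" "e > 0"
  shows "poly_eval (\<lambda>_. 0) F = 0"
  using poly_eval_scale[OF assms(1), of 0 "\<lambda>_. 0"] assms(2) by (simp add: power_0_left)

section \<open>Degrees of sums, products and determinants of forms\<close>

lemma degree_monom_add:
  fixes m m' :: "'v monom"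
  shows "(\<Sum>x\<in>Poly_Mapping.keys (m + m'). Poly_Mapping.lookup (m + m') x) =
    (\<Sum>x\<in>Poly_Mapping.keys m. Poly_Mapping.lookup m x) +
    (\<Sum>x\<in>Poly_Mapping.keys m'. Poly_Mapping.lookup m' x)"
proof -
  let ?A = "Poly_Mapping.keys m \<union> Poly_Mapping.keys m'"
  have *: "(\<Sum>x\<in>Poly_Mapping.keys u. Poly_Mapping.lookup u x) = (\<Sum>x\<in>?A. Poly_Mapping.lookup u x)"
    if "Poly_Mapping.keys u \<subseteq> ?A" for u :: "'v monom"
    using that by (intro sum.mono_neutral_left) (auto simp: in_keys_iff)
  show ?thesis
    using Poly_Mapping.keys_add[of m m']
    by (subst (1 2 3) *) (auto simp: lookup_add sum.distrib)
qed

lemma monomials_add: "m \<in> monomials X d \<Longrightarrow> m' \<in> monomials X e \<Longrightarrow> m + m' \<in> monomials X (d + e)"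
  using Poly_Mapping.keys_add[of m m'] by (auto simp: monomials_def degree_monom_add)

lemma single_in_monomials: "x \<in> X \<Longrightarrow> Poly_Mapping.single x d \<in> monomials X d"
  by (simp add: monomials_def)

lemma forms_0: "0 \<in> forms X d"
  by (simp add: forms_def)

lemma forms_1: "1 \<in> forms X 0"
  by (simp add: forms_def monomials_def)

lemma forms_add: "p \<in> forms X d \<Longrightarrow> q \<in> forms X d \<Longrightarrow> p + q \<in> forms X d"
  using Poly_Mapping.keys_add[of p q] by (auto simp: forms_def)

lemma forms_uminus: "p \<in> forms X d \<Longrightarrow> - p \<in> forms X d"
  by (simp add: forms_def)

lemma forms_sum: "(\<And>i. i \<in> I \<Longrightarrow> f i \<in> forms X d) \<Longrightarrow> (\<Sum>i\<in>I. f i) \<in> forms X d"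
  by (induction I rule: infinite_finite_induct) (auto simp: forms_0 forms_add)

lemma forms_mult: "p \<in> forms X d \<Longrightarrow> q \<in> forms X e \<Longrightarrow> p * q \<in> forms X (d + e)"
  using Poly_Mapping.keys_mult[of p q] by (fastforce simp: forms_def intro: monomials_add)

lemma forms_prod:
  assumes "finite I" "\<And>i. i \<in> I \<Longrightarrow> f i \<in> forms X d"
  shows "(\<Prod>i\<in>I. f i) \<in> forms X (card I * d)"
  using assms by (induction I rule: finite_induct) (auto simp: forms_1 intro: forms_mult)

lemma forms_single: "m \<in> monomials X d \<Longrightarrow> Poly_Mapping.single m c \<in> forms X d"
  by (simp add: forms_def)

lemma subspace_forms: "cpoly.subspace (forms X d)"
proof (rule cpoly.subspaceI)
  fix c p assume "p \<in> forms X d"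
  then show "cscale c p \<in> forms X d"
    by (auto simp: forms_def in_keys_iff lookup_cscale subset_iff)
qed (auto simp: forms_0 forms_add)

text \<open>Each Leibniz term is, up to sign, a product of \<open>n\<close> entries of degree
  \<open>d\<close>.\<close>

lemma forms_det:
  assumes "A \<in> carrier_mat n n" "\<And>i j. i < n \<Longrightarrow> j < n \<Longrightarrow> A $$ (i, j) \<in> forms X d"
  shows "Determinant.det A \<in> forms X (n * d)"
proof -
  have "signof p * q \<in> forms X (n * d)" if "q \<in> forms X (n * d)" for p q
    using that by (simp add: sign_def forms_uminus)
  moreover have "(\<Prod>i = 0..<n. A $$ (i, p i)) \<in> forms X (n * d)" if "p permutes {0..<n}" for p
  proof -
    have "A $$ (i, p i) \<in> forms X d" if "i \<in> {0..<n}" for i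
      using that permutes_in_image[OF \<open>p permutes {0..<n}\<close>, of i] by (intro assms(2)) auto
    from forms_prod[OF _ this, of "{0..<n}"] show ?thesis by simp
  qed
  ultimately show ?thesis
    by (subst det_def'[OF assms(1)], intro forms_sum) auto
qed

section \<open>Pluecker coordinates\<close>

text \<open>In any columns \<open>ms\<close>, the coefficient matrix of \<open>B'\<close> is the
  matrix \<open>g\<close> times that of \<open>B\<close>, and determinants multiply.\<close>

lemma pluecker_change_of_basis:
  assumes "length B' = length B"
    "\<And>i. i < length B \<Longrightarrow> B' ! i = (\<Sum>j<length B. cscale (g i j) (B ! j))"
  shows "pluecker B' ms =
    Determinant.det (Matrix.mat (length B) (length B) (\<lambda>(i, j). g i j)) * pluecker B ms"
proof -
  let ?r = "length B"
  let ?M = "Matrix.mat ?r ?r (\<lambda>(i, j). Poly_Mapping.lookup (B ! i) (ms ! j))"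
  let ?G = "Matrix.mat ?r ?r (\<lambda>(i, j). g i j)"
  have "Matrix.mat ?r ?r (\<lambda>(i, j). Poly_Mapping.lookup (B' ! i) (ms ! j)) = ?G * ?M"
    by (rule eq_matI)
      (auto simp: assms(2) scalar_prod_def Poly_Mapping.lookup_sum lookup_cscale
        lessThan_atLeast0)
  then have "pluecker B' ms = Determinant.det (?G * ?M)"
    unfolding pluecker_def assms(1) by (rule arg_cong)
  also have "\<dots> = Determinant.det ?G * Determinant.det ?M"
    by (rule Determinant.det_mult) auto
  finally show ?thesis
    by (simp add: pluecker_def)
qed

lemma span_set_conv_nth:
  assumes "distinct B" "p \<in> cpoly.span (set B)"
  obtains u where "p = (\<Sum>j<length B. cscale (u j) (B ! j))"
proof -
  obtain u where "p = (\<Sum>v\<in>set B. cscale (u v) v)"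
    using assms(2) by (auto simp: cpoly.span_finite)
  also have "\<dots> = (\<Sum>j<length B. cscale (u (B ! j)) (B ! j))"
    by (rule sum.reindex_bij_betw[symmetric]) (simp add: bij_betw_nth assms(1))
  finally show ?thesis
    by (rule that)
qed

text \<open>The scalar \<open>c\<close> is the determinant of the matrix expressing
  \<open>B'\<close> through \<open>B\<close>, hence the same for every \<open>ms\<close>.\<close>

lemma basis_list_change_of_basis:
  assumes "basis_list L B" "basis_list L B'"
  obtains c where "pluecker B' = (\<lambda>ms. c * pluecker B ms)"
proof -
  have B: "distinct B" "cpoly.independent (set B)" "cpoly.span (set B) = L"
    and B': "distinct B'" "cpoly.independent (set B')" "cpoly.span (set B') = L"
    using assms by (auto simp: basis_list_def lin_indep_list_def)
  have len: "length B' = length B"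
    using cpoly.dim_span_eq_card_independent[OF B(2)] cpoly.dim_span_eq_card_independent[OF B'(2)]
      B B' by (simp add: distinct_card)
  have "\<exists>u. B' ! i = (\<Sum>j<length B. cscale (u j) (B ! j))" if "i < length B" for i
  proof -
    have "B' ! i \<in> cpoly.span (set B)"
      using that len B(3) B'(3) by (metis cpoly.span_base nth_mem)
    then show ?thesis
      using span_set_conv_nth[OF B(1)] by metis
  qed
  then obtain g where "\<And>i. i < length B \<Longrightarrow> B' ! i = (\<Sum>j<length B. cscale (g i j) (B ! j))"
    by metis
  from pluecker_change_of_basis[OF len this] that show ?thesis
    by blast
qed

text \<open>A repeated member gives two equal rows, and a linear relation gives a nonzero kernel
  vector of the transpose; either would make the minor vanish.\<close>

lemma pluecker_nonzero_lin_indep: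
  assumes "pluecker B ms \<noteq> 0"
  shows "lin_indep_list B"
proof -
  let ?r = "length B"
  let ?M = "Matrix.mat ?r ?r (\<lambda>(i, j). Poly_Mapping.lookup (B ! i) (ms ! j))"
  have "distinct B"
  proof (rule ccontr)
    assume "\<not> distinct B"
    then obtain i j where ij: "i < ?r" "j < ?r" "i \<noteq> j" "B ! i = B ! j"
      by (auto simp: distinct_conv_nth)
    then have "Determinant.det ?M = 0"
      by (intro det_identical_rows[of ?M ?r i j]) auto
    with assms show False
      by (simp add: pluecker_def)
  qed
  moreover have "cpoly.independent (set B)"
  proof
    assume "cpoly.dependent (set B)"
    then obtain u where u: "\<exists>v\<in>set B. u v \<noteq> 0" "(\<Sum>v\<in>set B. cscale (u v) v) = 0"
      by (auto simp: cpoly.dependent_finite)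
    define x where "x = Matrix.vec ?r (\<lambda>i. u (B ! i))"
    have x: "x \<in> carrier_vec ?r" "x \<noteq> 0\<^sub>v ?r"
      using u(1) by (auto simp: x_def vec_eq_iff in_set_conv_nth)
    have "(\<Sum>i<?r. cscale (u (B ! i)) (B ! i)) = 0"
      using sum.reindex_bij_betw[OF bij_betw_nth[OF \<open>distinct B\<close>], of "{..<?r}" "set B"
          "\<lambda>v. cscale (u v) v"] u(2) by simp
    then have "(\<Sum>i<?r. u (B ! i) * Poly_Mapping.lookup (B ! i) m) = 0" for m
      by (metis (mono_tags, lifting) Poly_Mapping.lookup_sum lookup_cscale lookup_zero sum.cong)
    then have "transpose_mat ?M *\<^sub>v x = 0\<^sub>v ?r"
      by (intro eq_vecI) (auto simp: scalar_prod_def x_def lessThan_atLeast0 mult.commute)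
    with x have "Determinant.det (transpose_mat ?M) = 0"
      by (subst det_0_iff_vec_prod_zero[of _ ?r]) auto
    then have "Determinant.det ?M = 0"
      by (subst (asm) Determinant.det_transpose[of _ ?r]) auto
    with assms show False
      by (simp add: pluecker_def)
  qed
  ultimately show ?thesis
    by (simp add: lin_indep_list_def)
qed

text \<open>Cramer's rule: expanding the minor along the varying column exhibits a fixed combination of
  the basis.\<close>

lemma pluecker_update:
  assumes "c < length B" "length ms = length B"
  shows "pluecker B (ms[c := m]) = Poly_Mapping.lookup (\<Sum>j<length B.
    cscale (cofactor (Matrix.mat (length B) (length B)
      (\<lambda>(i, j). Poly_Mapping.lookup (B ! i) (ms ! j))) j c) (B ! j)) m"
proof -
  let ?r = "length B"
  let ?M = "\<lambda>ms. Matrix.mat ?r ?r (\<lambda>(i, j). Poly_Mapping.lookup (B ! i) (ms ! j))"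
  have cof: "cofactor (?M (ms[c := m])) j c = cofactor (?M ms) j c" if "j < ?r" for j
  proof -
    have "mat_delete (?M (ms[c := m])) j c = mat_delete (?M ms) j c"
      using that assms by (intro eq_matI) (auto simp: mat_delete_def)
    then show ?thesis
      by (simp add: cofactor_def)
  qed
  have "pluecker B (ms[c := m]) =
      (\<Sum>j<?r. ?M (ms[c := m]) $$ (j, c) * cofactor (?M (ms[c := m])) j c)"
    unfolding pluecker_def by (rule laplace_expansion_column) (use assms in auto)
  then show ?thesis
    using assms by (simp add: cof Poly_Mapping.lookup_sum lookup_cscale mult.commute)
qed

lemma pluecker_update_in_span:
  assumes "c < length B" "length ms = length B"
  obtains p where "p \<in> cpoly.span (set B)" "\<And>m. pluecker B (ms[c := m]) = Poly_Mapping.lookup p m"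
proof
  show "(\<Sum>j<length B. cscale (cofactor (Matrix.mat (length B) (length B)
      (\<lambda>(i, j). Poly_Mapping.lookup (B ! i) (ms ! j))) j c) (B ! j)) \<in> cpoly.span (set B)"
    by (intro cpoly.span_sum cpoly.span_scale cpoly.span_base) auto
qed (rule pluecker_update[OF assms])

text \<open>In reduced echelon form with pivots \<open>ms\<close> the coefficient minor is the
  identity matrix, which is its own adjugate. The combination from Cramer's rule is then the single
  basis element \<open>B ! c\<close>.\<close>

lemma pluecker_update_echelon:
  assumes "c < length B" "length ms = length B"
    and ech: "\<And>i j. i < length B \<Longrightarrow> j < length B \<Longrightarrow>
      Poly_Mapping.lookup (B ! i) (ms ! j) = (if i = j then 1 else 0)"
  shows "pluecker B (ms[c := m]) = Poly_Mapping.lookup (B ! c) m"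
proof -
  let ?r = "length B"
  have one: "Matrix.mat ?r ?r (\<lambda>(i, j). Poly_Mapping.lookup (B ! i) (ms ! j)) = 1\<^sub>m ?r"
    by (rule eq_matI) (auto simp: ech)
  have "adj_mat (1\<^sub>m ?r :: complex mat) = 1\<^sub>m ?r"
    using adj_mat(1,2)[of "1\<^sub>m ?r :: complex mat" ?r] by auto
  then have "adj_mat (1\<^sub>m ?r :: complex mat) $$ (c, j) = (if j = c then 1 else 0)" if "j < ?r" for j
    using that assms(1) by simp
  then have "cofactor (1\<^sub>m ?r :: complex mat) j c = (if j = c then 1 else 0)" if "j < ?r" for j
    using that assms(1) by (simp add: adj_mat_def)
  then have "(\<Sum>j<?r. cofactor (1\<^sub>m ?r :: complex mat) j c * Poly_Mapping.lookup (B ! j) m) =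
      (\<Sum>j<?r. if j = c then Poly_Mapping.lookup (B ! j) m else 0)"
    by (intro sum.cong) auto
  with assms(1) show ?thesis
    by (simp add: pluecker_update[OF assms(1,2)] one Poly_Mapping.lookup_sum lookup_cscale)
qed

section \<open>Irreducibility of the Grassmannian\<close>

text \<open>Writing the witness basis \<open>B'\<close> through \<open>B\<close> turns the nonzero
  value at \<open>B'\<close> into \<open>c ^ e\<close> times the value at \<open>B\<close>, so the
  latter is nonzero too.\<close>

lemma nonvanishing_locus_all_bases:
  assumes "F \<in> forms X e" "L \<in> nonvanishing_locus n d r F" "basis_list L B"
  shows "poly_eval (pluecker B) F \<noteq> 0"
proof -
  obtain B' where B': "basis_list L B'" "poly_eval (pluecker B') F \<noteq> 0"
    using assms(2) by (auto simp: nonvanishing_locus_def)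
  obtain c where "pluecker B' = (\<lambda>ms. c * pluecker B ms)"
    using basis_list_change_of_basis[OF assms(3) B'(1)] .
  with B'(2) show ?thesis
    by (simp add: poly_eval_scale[OF assms(1)])
qed

text \<open>The two loci on the right may be witnessed by different bases;
  \<open>nonvanishing_locus_all_bases\<close> moves both conditions to one basis.\<close>

lemma nonvanishing_locus_mult:
  assumes "F \<in> forms X e" "G \<in> forms Y e'"
  shows "nonvanishing_locus n d r (F * G) =
    nonvanishing_locus n d r F \<inter> nonvanishing_locus n d r G"
proof
  show "nonvanishing_locus n d r F \<inter> nonvanishing_locus n d r G
      \<subseteq> nonvanishing_locus n d r (F * G)"
  proof
    fix L assume L: "L \<in> nonvanishing_locus n d r F \<inter> nonvanishing_locus n d r G"
    then obtain B where "L \<in> Grass r (Sym_forms n d)" "basis_list L B"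
      by (auto simp: nonvanishing_locus_def)
    moreover from this L have "poly_eval (pluecker B) (F * G) \<noteq> 0"
      using nonvanishing_locus_all_bases assms by (simp add: poly_eval_mult) blast
    ultimately show "L \<in> nonvanishing_locus n d r (F * G)"
      by (auto simp: nonvanishing_locus_def)
  qed
qed (auto simp: nonvanishing_locus_def poly_eval_mult)

lemma openin_zariski_Grass_nonvanishing_locus:
  assumes "F \<in> forms (pluecker_vars n d r) e"
  shows "openin (zariski_Grass n d r) (nonvanishing_locus n d r F)"
  using assms unfolding zariski_Grass_def openin_topology_generated_by_iff
  by (blast intro: generate_topology_on.Basis)

text \<open>The generating loci form a base of the topology and not only a subbase, since the locus
  of a product is the intersection of the loci.\<close>

lemma openin_zariski_GrassE:
  assumes "openin (zariski_Grass n d r) U" "L \<in> U"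
  obtains F e where "F \<in> forms (pluecker_vars n d r) e" "L \<in> nonvanishing_locus n d r F"
    "nonvanishing_locus n d r F \<subseteq> U"
proof -
  have "\<exists>F e. F \<in> forms (pluecker_vars n d r) e \<and> L \<in> nonvanishing_locus n d r F \<and>
    nonvanishing_locus n d r F \<subseteq> U"
    using assms unfolding zariski_Grass_def openin_topology_generated_by_iff
  proof (induction rule: generate_topology_on.induct)
    case (Int U V)
    from Int.IH(1) Int.prems obtain F e where
      F: "F \<in> forms (pluecker_vars n d r) e" "L \<in> nonvanishing_locus n d r F"
        "nonvanishing_locus n d r F \<subseteq> U"
      by (elim IntE) metis
    from Int.IH(2) Int.prems obtain G e' where
      G: "G \<in> forms (pluecker_vars n d r) e'" "L \<in> nonvanishing_locus n d r G"
        "nonvanishing_locus n d r G \<subseteq> V"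
      by (elim IntE) metis
    from F(2,3) G(2,3) forms_mult[OF F(1) G(1)] show ?case
      by (intro exI[of _ "F * G"] exI[of _ "e + e'"])
        (auto simp: nonvanishing_locus_mult[OF F(1) G(1)])
  next
    case (UN K)
    then obtain U where "U \<in> K" "L \<in> U"
      by blast
    from UN.IH[OF this] \<open>U \<in> K\<close> show ?case
      by blast
  qed auto
  then show ?thesis
    using that by blast
qed

section \<open>Polynomial functions of one variable\<close>

definition polynomial_fun :: "('a::comm_ring_1 \<Rightarrow> 'a) \<Rightarrow> bool" where
  "polynomial_fun f \<longleftrightarrow> (\<exists>p. f = poly p)"

lemma polynomial_fun_const: "polynomial_fun (\<lambda>_. c)"
  unfolding polynomial_fun_def by (rule exI[of _ "[:c:]"]) auto

lemma polynomial_fun_id: "polynomial_fun (\<lambda>t. t)"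
  unfolding polynomial_fun_def by (rule exI[of _ "[:0, 1:]"]) auto

lemma polynomial_fun_add:
  "polynomial_fun f \<Longrightarrow> polynomial_fun g \<Longrightarrow> polynomial_fun (\<lambda>t. f t + g t)"
  unfolding polynomial_fun_def by (auto simp flip: poly_add)

lemma polynomial_fun_mult:
  "polynomial_fun f \<Longrightarrow> polynomial_fun g \<Longrightarrow> polynomial_fun (\<lambda>t. f t * g t)"
  unfolding polynomial_fun_def by (auto simp flip: poly_mult)

lemma polynomial_fun_power: "polynomial_fun f \<Longrightarrow> polynomial_fun (\<lambda>t. f t ^ k)"
  by (induction k) (simp_all add: polynomial_fun_const polynomial_fun_mult)

lemma polynomial_fun_sum:
  "(\<And>i. i \<in> I \<Longrightarrow> polynomial_fun (f i)) \<Longrightarrow> polynomial_fun (\<lambda>t. \<Sum>i\<in>I. f i t)"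
  by (induction I rule: infinite_finite_induct)
    (simp_all add: polynomial_fun_const polynomial_fun_add)

lemma polynomial_fun_prod:
  "(\<And>i. i \<in> I \<Longrightarrow> polynomial_fun (f i)) \<Longrightarrow> polynomial_fun (\<lambda>t. \<Prod>i\<in>I. f i t)"
  by (induction I rule: infinite_finite_induct)
    (simp_all add: polynomial_fun_const polynomial_fun_mult)

lemmas polynomial_fun_intros = polynomial_fun_const polynomial_fun_id polynomial_fun_add
  polynomial_fun_mult polynomial_fun_power polynomial_fun_sum polynomial_fun_prod

text \<open>The product of the two polynomials is not the zero polynomial, so it has finitely many
  roots in an infinite ring.\<close>

lemma polynomial_fun_common_nonzero:
  fixes f g :: "'a::{idom,ring_char_0} \<Rightarrow> 'a"
  assumes "polynomial_fun f" "polynomial_fun g" "f a \<noteq> 0" "g b \<noteq> 0"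
  obtains t where "f t \<noteq> 0" "g t \<noteq> 0"
proof -
  obtain p q where pq: "f = poly p" "g = poly q"
    using assms(1,2) by (auto simp: polynomial_fun_def)
  with assms(3,4) have "p * q \<noteq> 0"
    by auto
  then have "finite {t. poly (p * q) t = 0}"
    by (rule poly_roots_finite)
  then obtain t where "poly (p * q) t \<noteq> 0"
    using ex_new_if_finite[OF infinite_UNIV_char_0] by blast
  with pq that show ?thesis
    by auto
qed

section \<open>Lines joining two bases, and irreducibility\<close>

text \<open>The affine line from \<open>B\<close> at \<open>t = 0\<close> to \<open>B'\<close> at
  \<open>t = 1\<close>. The list may become linearly dependent at particular values of
  \<open>t\<close>.\<close>

definition pencil :: "'v cpoly list \<Rightarrow> 'v cpoly list \<Rightarrow> complex \<Rightarrow> 'v cpoly list" where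
  "pencil B B' t = map2 (\<lambda>b b'. b + cscale t (b' - b)) B B'"

lemma length_pencil [simp]: "length (pencil B B' t) = min (length B) (length B')"
  by (simp add: pencil_def)

lemma nth_pencil:
  "i < length B \<Longrightarrow> i < length B' \<Longrightarrow> pencil B B' t ! i = B ! i + cscale t (B' ! i - B ! i)"
  by (simp add: pencil_def)

lemma pencil_0: "length B = length B' \<Longrightarrow> pencil B B' 0 = B"
  by (rule nth_equalityI) (auto simp: nth_pencil)

lemma pencil_1: "length B = length B' \<Longrightarrow> pencil B B' 1 = B'"
  by (rule nth_equalityI) (auto simp: nth_pencil)

text \<open>By the Leibniz formula the minor is a sum of signed products of affine functions of
  \<open>t\<close>.\<close>

lemma polynomial_fun_pluecker_pencil:
  assumes "length B = length B'"
  shows "polynomial_fun (\<lambda>t. pluecker (pencil B B' t) ms)"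
proof -
  have "pluecker (pencil B B' t) ms = (\<Sum>p | p permutes {0..<length B}. signof p *
    (\<Prod>i = 0..<length B. Poly_Mapping.lookup (B ! i) (ms ! p i) +
      t * Poly_Mapping.lookup (B' ! i - B ! i) (ms ! p i)))" for t
    unfolding pluecker_def using assms
    by (subst det_def'[of _ "length B"])
      (auto simp: nth_pencil lookup_add lookup_cscale permutes_in_image
        intro!: sum.cong prod.cong)
  then show ?thesis
    by (simp add: polynomial_fun_intros)
qed

lemma polynomial_fun_poly_eval_pencil:
  assumes "length B = length B'"
  shows "polynomial_fun (\<lambda>t. poly_eval (pluecker (pencil B B' t)) F)"
  unfolding poly_eval_def
  by (intro polynomial_fun_intros polynomial_fun_pluecker_pencil assms)

lemma length_basis_list: "basis_list L B \<Longrightarrow> length B = cpoly.dim L"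
  using cpoly.dim_span_eq_card_independent[of "set B"]
  by (auto simp: basis_list_def lin_indep_list_def distinct_card)

lemma basis_list_span: "lin_indep_list B \<Longrightarrow> basis_list (cpoly.span (set B)) B"
  by (simp add: basis_list_def)

lemma span_in_Grass:
  assumes "lin_indep_list B" "cpoly.subspace W" "set B \<subseteq> W"
  shows "cpoly.span (set B) \<in> Grass (length B) W"
  using assms length_basis_list[OF basis_list_span[OF assms(1)]]
  by (simp add: Grass_def cpoly.subspace_span cpoly.span_minimal)

text \<open>Along the line joining two bases, \<open>F\<close> and \<open>G\<close> become
  polynomials in \<open>t\<close> that are nonzero at 0 and at 1 respectively. Some \<open>t\<close>
  avoids the roots of both, and the span at that \<open>t\<close> is the common point.\<close>

lemma nonvanishing_loci_meet:
  assumes F: "F \<in> forms X e" and L: "L \<in> nonvanishing_locus n d r F"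
    and G: "G \<in> forms Y e'" and L': "L' \<in> nonvanishing_locus n d r G"
  shows "nonvanishing_locus n d r F \<inter> nonvanishing_locus n d r G \<noteq> {}"
proof -
  obtain B B' where B: "basis_list L B" "poly_eval (pluecker B) F \<noteq> 0"
    and B': "basis_list L' B'" "poly_eval (pluecker B') G \<noteq> 0"
    and LL': "L \<in> Grass r (Sym_forms n d)" "L' \<in> Grass r (Sym_forms n d)"
    using L L' by (auto simp: nonvanishing_locus_def)
  show ?thesis
  proof (cases "e = 0")
    case True
    \<comment> \<open>A form of degree 0 takes the same value everywhere, so \<open>L'\<close>
      itself lies in both loci.\<close>
    with F B(2) have "poly_eval (pluecker B') F \<noteq> 0"
      using poly_eval_forms_0 by metis
    with B'(1) LL' L' show ?thesis
      by (auto simp: nonvanishing_locus_def)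
  next
    case False
    have len: "length B = r" "length B' = r"
      using LL' length_basis_list[OF B(1)] length_basis_list[OF B'(1)] by (auto simp: Grass_def)
    obtain t where t: "poly_eval (pluecker (pencil B B' t)) F \<noteq> 0"
      "poly_eval (pluecker (pencil B B' t)) G \<noteq> 0"
      using polynomial_fun_common_nonzero[of "\<lambda>t. poly_eval (pluecker (pencil B B' t)) F"
          "\<lambda>t. poly_eval (pluecker (pencil B B' t)) G" 0 1]
        polynomial_fun_poly_eval_pencil[of B B'] B(2) B'(2) len
      by (auto simp: pencil_0 pencil_1)
    let ?C = "pencil B B' t"
    \<comment> \<open>A form of positive degree vanishes at the origin, so some minor of
      \<open>?C\<close> is nonzero. Hence \<open>?C\<close> is independent and its span has the
      right dimension.\<close>
    have "pluecker ?C \<noteq> (\<lambda>_. 0)"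
      using t(1) poly_eval_forms_at_0[OF F] False by auto
    then have indep: "lin_indep_list ?C"
      using pluecker_nonzero_lin_indep by blast
    have W: "cpoly.subspace (Sym_forms n d)"
      by (simp add: Sym_forms_def subspace_forms)
    have "set B \<subseteq> L" "set B' \<subseteq> L'"
      using B(1) B'(1) cpoly.span_superset by (metis basis_list_def)+
    moreover have "L \<subseteq> Sym_forms n d" "L' \<subseteq> Sym_forms n d"
      using LL' by (simp_all add: Grass_def)
    ultimately have "set B \<subseteq> Sym_forms n d" "set B' \<subseteq> Sym_forms n d"
      by simp_all
    then have "B ! i \<in> Sym_forms n d" "B' ! i \<in> Sym_forms n d" if "i < r" for i
      using that len by (metis nth_mem subsetD)+
    then have "set ?C \<subseteq> Sym_forms n d"
      using len by (auto simp: in_set_conv_nth nth_pencil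
          intro!: cpoly.subspace_add[OF W] cpoly.subspace_scale[OF W] cpoly.subspace_diff[OF W])
    with indep have "cpoly.span (set ?C) \<in> Grass r (Sym_forms n d)"
      using span_in_Grass[OF _ W, of ?C] len by simp
    with t basis_list_span[OF indep] show ?thesis
      by (auto simp: nonvanishing_locus_def)
  qed
qed

text \<open>The complements of two proper closed subsets are nonempty and open, so they contain
  basic loci, and these meet.\<close>

lemma irreducible_closed_topspace_zariski_Grass:
  assumes "topspace (zariski_Grass n d r) \<noteq> {}"
  shows "irreducible_closed (zariski_Grass n d r) (topspace (zariski_Grass n d r))"
proof -
  let ?X = "zariski_Grass n d r"
  have False if A: "closedin ?X A" and B: "closedin ?X B" and AB: "topspace ?X = A \<union> B"
    and ne: "topspace ?X \<noteq> A" "topspace ?X \<noteq> B" for A B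
  proof -
    have "topspace ?X - A \<noteq> {}" "topspace ?X - B \<noteq> {}"
      using closedin_subset[OF A] closedin_subset[OF B] ne by (metis Diff_eq_empty_iff subset_antisym)+
    then obtain L L' where L: "L \<in> topspace ?X - A" and L': "L' \<in> topspace ?X - B"
      by (meson ex_in_conv)
    have op: "openin ?X (topspace ?X - A)" "openin ?X (topspace ?X - B)"
      using A B by auto
    obtain F e where "F \<in> forms (pluecker_vars n d r) e" "L \<in> nonvanishing_locus n d r F"
      "nonvanishing_locus n d r F \<subseteq> topspace ?X - A"
      using openin_zariski_GrassE[OF op(1) L] .
    moreover obtain G e' where "G \<in> forms (pluecker_vars n d r) e'"
      "L' \<in> nonvanishing_locus n d r G" "nonvanishing_locus n d r G \<subseteq> topspace ?X - B"
      using openin_zariski_GrassE[OF op(2) L'] .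
    ultimately have "(topspace ?X - A) \<inter> (topspace ?X - B) \<noteq> {}"
      using nonvanishing_loci_meet[of F _ e L n d r G _ e' L'] by blast
    with AB show False
      by blast
  qed
  with assms show ?thesis
    unfolding irreducible_closed_def by (metis closedin_topspace)
qed

text \<open>Every irreducible closed \<open>Z\<close> inside the closure of \<open>Y\<close> is a
  proper subset of the space, so \<open>Z\<close> followed by the whole space is a chain of length
  1.\<close>

lemma codim_ge_1:
  assumes "irreducible_closed X (topspace X)" "X closure_of Y \<noteq> topspace X"
  shows "codim X Y \<ge> 1"
  unfolding codim_def
proof (rule INF_greatest)
  fix Z assume Z: "Z \<in> {Z. irreducible_closed X Z \<and> Z \<subseteq> X closure_of Y}"
  define C where "C = (\<lambda>i::nat. if i = 0 then Z else topspace X)"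
  have "Z \<subset> topspace X"
    using Z assms(2) closure_of_subset_topspace[of X Y] by blast
  then have "C 0 = Z \<and> (\<forall>i\<le>1. irreducible_closed X (C i)) \<and> (\<forall>i<1. C i \<subset> C (Suc i))"
    using Z assms(1) by (auto simp: C_def)
  then have "enat 1 \<le> codim_irreducible X Z"
    unfolding codim_irreducible_def by (intro Sup_upper) blast
  then show "1 \<le> codim_irreducible X Z"
    by (simp add: one_enat_def)
qed

section \<open>The Koszul matrix of three symmetric matrices\<close>

text \<open>This is \<open>[0, H 2, - H 1; - H 2, 0, H 0; H 1, - H 0, 0]\<close> in block form.\<close>

definition koszul_mat :: "nat \<Rightarrow> (nat \<Rightarrow> nat \<Rightarrow> nat \<Rightarrow> 'a::comm_ring_1) \<Rightarrow> 'a mat" where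
  "koszul_mat N H = Matrix.mat (3 * N) (3 * N) (\<lambda>(k, l).
    if l div N = (k div N + 1) mod 3 then H ((k div N + 2) mod 3) (k mod N) (l mod N)
    else if l div N = (k div N + 2) mod 3 then - H ((k div N + 1) mod 3) (k mod N) (l mod N)
    else 0)"

lemma koszul_mat_carrier: "koszul_mat N H \<in> carrier_mat (3 * N) (3 * N)"
  by (simp add: koszul_mat_def)

lemma lessThan_3: "{..<3} = {0, 1, 2::nat}"
  by auto

lemma less_3_cases: "a < 3 \<Longrightarrow> a = 0 \<or> a = 1 \<or> a = (2::nat)"
  by auto

lemma block_index_less:
  assumes "a < 3" "i < N"
  shows "a * N + i < 3 * (N::nat)"
proof -
  have "a * N + i < Suc a * N"
    using assms(2) by simp
  also have "\<dots> \<le> 3 * N"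
    using assms(1) by (intro mult_le_mono1) auto
  finally show ?thesis .
qed

lemma sum_blocks: "(\<Sum>k<n * N. g k) = (\<Sum>b<n. \<Sum>j<N. g (b * N + j :: nat))"
proof -
  have "sum g {b * N..<b * N + N} = (\<Sum>j<N. g (b * N + j))" for b
    by (rule sum.reindex_bij_witness[of _ "\<lambda>j. b * N + j" "\<lambda>k. k - b * N"]) auto
  then show ?thesis
    by (simp flip: sum.nat_group)
qed

text \<open>Block row \<open>a\<close> is the \<open>a\<close>-th component of the cross product of
  the three blocks of \<open>v\<close> with the triple \<open>H\<close>, indices being cyclic modulo
  3.\<close>

lemma koszul_mat_mult_vec:
  assumes "v \<in> carrier_vec (3 * N)" "a < 3" "i < N"
  shows "(koszul_mat N H *\<^sub>v v) $ (a * N + i) =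
    (\<Sum>j<N. H ((a + 2) mod 3) i j * v $ ((a + 1) mod 3 * N + j)) -
    (\<Sum>j<N. H ((a + 1) mod 3) i j * v $ ((a + 2) mod 3 * N + j))"
proof -
  have k: "a * N + i < 3 * N"
    using assms(2,3) by (rule block_index_less)
  have "(koszul_mat N H *\<^sub>v v) $ (a * N + i) =
      (\<Sum>l<3 * N. koszul_mat N H $$ (a * N + i, l) * v $ l)"
    using k assms(1) by (simp add: koszul_mat_def scalar_prod_def lessThan_atLeast0)
  also have "\<dots> = (\<Sum>b<3. \<Sum>j<N. koszul_mat N H $$ (a * N + i, b * N + j) * v $ (b * N + j))"
    by (rule sum_blocks)
  also have "\<dots> = (\<Sum>b<3. \<Sum>j<N. (if b = (a + 1) mod 3 then H ((a + 2) mod 3) i j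
      else if b = (a + 2) mod 3 then - H ((a + 1) mod 3) i j else 0) * v $ (b * N + j))"
    using k assms(3) by (intro sum.cong refl) (simp add: koszul_mat_def block_index_less)
  also have "\<dots> = (\<Sum>j<N. H ((a + 2) mod 3) i j * v $ ((a + 1) mod 3 * N + j)) -
      (\<Sum>j<N. H ((a + 1) mod 3) i j * v $ ((a + 2) mod 3 * N + j))"
    using less_3_cases[OF assms(2)] by (auto simp: lessThan_3 sum_negf mult_2)
  finally show ?thesis .
qed

section \<open>Rank bound when the slices are sums of rank one matrices\<close>

lemma exists_common_zero:
  fixes f :: "nat \<Rightarrow> nat \<Rightarrow> 'a::field"
  assumes "m < n"
  obtains v where "v \<in> carrier_vec n" "v \<noteq> 0\<^sub>v n" "\<And>l. l < m \<Longrightarrow> (\<Sum>c<n. f l c * v $ c) = 0"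
proof -
  \<comment> \<open>The \<open>m\<close> equations are padded with zero rows to a square matrix. Row
    \<open>m\<close> is then zero, so \<open>unit_vec n m\<close> is in the kernel of the transpose
    and the determinant vanishes.\<close>
  define A where "A = Matrix.mat n n (\<lambda>(l, c). if l < m then f l c else 0)"
  have A: "A \<in> carrier_mat n n"
    by (simp add: A_def)
  have "transpose_mat A *\<^sub>v unit_vec n m = 0\<^sub>v n"
    using assms by (intro eq_vecI) (auto simp: A_def scalar_prod_right_unit)
  moreover have "unit_vec n m \<noteq> (0\<^sub>v n :: 'a vec)"
    using assms by simp
  ultimately have "Determinant.det (transpose_mat A) = 0"
    using A by (subst det_0_iff_vec_prod_zero[of _ n]) (auto intro: exI[of _ "unit_vec n m"])
  then have "Determinant.det A = 0"
    using Determinant.det_transpose[OF A] by simp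
  then obtain v where v: "v \<in> carrier_vec n" "v \<noteq> 0\<^sub>v n" "A *\<^sub>v v = 0\<^sub>v n"
    using det_0_iff_vec_prod_zero[OF A] by blast
  have "(\<Sum>c<n. f l c * v $ c) = 0" if "l < m" for l
  proof -
    have "(A *\<^sub>v v) $ l = (\<Sum>c<n. f l c * v $ c)"
      using that assms v(1) by (simp add: A_def scalar_prod_def lessThan_atLeast0)
    with v(3) that assms show ?thesis
      by simp
  qed
  with v that show ?thesis
    by blast
qed

text \<open>The cross product with a fixed vector has rank at most 2.\<close>

lemma cross_product_rank:
  fixes l :: "nat \<Rightarrow> 'a::field"
  shows "\<exists>f g. \<forall>y a. a < 3 \<longrightarrow> (\<Sum>b<3. f b * y b) = 0 \<longrightarrow> (\<Sum>b<3. g b * y b) = 0 \<longrightarrow>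
    l ((a + 2) mod 3) * y ((a + 1) mod 3) = l ((a + 1) mod 3) * y ((a + 2) mod (3::nat))"
proof (cases "\<forall>a<3. l a = 0")
  case True
  then show ?thesis
    by simp
next
  case False
  then consider "l 0 \<noteq> 0" | "l 1 \<noteq> 0" | "l 2 \<noteq> 0"
    using less_3_cases by blast
  then show ?thesis
  proof cases
    case 1
    show ?thesis
    \<comment> \<open>The two functionals state \<open>y 1 = l 1 / l 0 * y 0\<close> and
      \<open>y 2 = l 2 / l 0 * y 0\<close>: together they make \<open>y\<close> proportional to
      \<open>l\<close>, and parallel vectors have zero cross product. The other two cases permute
      the indices.\<close>
    proof (rule exI[of _ "\<lambda>b. if b = 0 then l 1 / l 0 else if b = 1 then - 1 else 0"],
        rule exI[of _ "\<lambda>b. if b = 0 then l 2 / l 0 else if b = 2 then - 1 else 0"],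
        intro allI impI)
      fix y :: "nat \<Rightarrow> 'a" and a :: nat
      assume "a < 3"
        "(\<Sum>b<3. (if b = 0 then l 1 / l 0 else if b = 1 then - 1 else 0) * y b) = 0"
        "(\<Sum>b<3. (if b = 0 then l 2 / l 0 else if b = 2 then - 1 else 0) * y b) = 0"
      then have "y 1 = l 1 / l 0 * y 0" "y 2 = l 2 / l 0 * y 0"
        by (auto simp: lessThan_3)
      with less_3_cases[OF \<open>a < 3\<close>] 1
      show "l ((a + 2) mod 3) * y ((a + 1) mod 3) = l ((a + 1) mod 3) * y ((a + 2) mod 3)"
        by (auto simp: numeral_2_eq_2)
    qed
  next
    case 2
    show ?thesis
    proof (rule exI[of _ "\<lambda>b. if b = 1 then l 0 / l 1 else if b = 0 then - 1 else 0"],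
        rule exI[of _ "\<lambda>b. if b = 1 then l 2 / l 1 else if b = 2 then - 1 else 0"],
        intro allI impI)
      fix y :: "nat \<Rightarrow> 'a" and a :: nat
      assume "a < 3"
        "(\<Sum>b<3. (if b = 1 then l 0 / l 1 else if b = 0 then - 1 else 0) * y b) = 0"
        "(\<Sum>b<3. (if b = 1 then l 2 / l 1 else if b = 2 then - 1 else 0) * y b) = 0"
      then have "y 0 = l 0 / l 1 * y 1" "y 2 = l 2 / l 1 * y 1"
        by (auto simp: lessThan_3)
      with less_3_cases[OF \<open>a < 3\<close>] 2
      show "l ((a + 2) mod 3) * y ((a + 1) mod 3) = l ((a + 1) mod 3) * y ((a + 2) mod 3)"
        by (auto simp: numeral_2_eq_2)
    qed
  next
    case 3
    show ?thesis
    proof (rule exI[of _ "\<lambda>b. if b = 2 then l 0 / l 2 else if b = 0 then - 1 else 0"],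
        rule exI[of _ "\<lambda>b. if b = 2 then l 1 / l 2 else if b = 1 then - 1 else 0"],
        intro allI impI)
      fix y :: "nat \<Rightarrow> 'a" and a :: nat
      assume "a < 3"
        "(\<Sum>b<3. (if b = 2 then l 0 / l 2 else if b = 0 then - 1 else 0) * y b) = 0"
        "(\<Sum>b<3. (if b = 2 then l 1 / l 2 else if b = 1 then - 1 else 0) * y b) = 0"
      then have "y 0 = l 0 / l 2 * y 2" "y 1 = l 1 / l 2 * y 2"
        by (auto simp: lessThan_3)
      with less_3_cases[OF \<open>a < 3\<close>] 3
      show "l ((a + 2) mod 3) * y ((a + 1) mod 3) = l ((a + 1) mod 3) * y ((a + 2) mod 3)"
        by (auto simp: numeral_2_eq_2)
    qed
  qed
qed

text \<open>A rank one slice \<open>lam c * q q\<^sup>T\<close> contributes at most 2 to the rank of the Koszul matrix.\<close>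

lemma det_koszul_mat_eq_0:
  fixes H :: "nat \<Rightarrow> nat \<Rightarrow> nat \<Rightarrow> 'a::field"
  assumes s: "2 * s < 3 * N"
    and H: "\<And>c i j. c < 3 \<Longrightarrow> i < N \<Longrightarrow> j < N \<Longrightarrow> H c i j = (\<Sum>k<s. lam k c * (q k i * q k j))"
  shows "Determinant.det (koszul_mat N H) = 0"
proof -
  define P where "P k f g \<longleftrightarrow> (\<forall>y a. a < 3 \<longrightarrow> (\<Sum>b<3. f b * y b) = 0 \<longrightarrow>
      (\<Sum>b<3. g b * y b) = 0 \<longrightarrow>
      lam k ((a + 2) mod 3) * y ((a + 1) mod 3) = lam k ((a + 1) mod 3) * y ((a + 2) mod 3))"
    for k f g
  have "\<forall>k. \<exists>f g. P k f g"
    unfolding P_def by (intro allI cross_product_rank)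
  then obtain f g where "\<And>k. P k (f k) (g k)"
    by metis
  then have fg: "\<And>k y a. a < 3 \<Longrightarrow> (\<Sum>b<3. f k b * y b) = 0 \<Longrightarrow> (\<Sum>b<3. g k b * y b) = 0 \<Longrightarrow>
      lam k ((a + 2) mod 3) * y ((a + 1) mod 3) = lam k ((a + 1) mod 3) * y ((a + 2) mod 3)"
    by (simp add: P_def)
  \<comment> \<open>These are the \<open>2 * s\<close> conditions imposed on \<open>v\<close>: each
    square contributes \<open>f k\<close> at index \<open>k\<close> and \<open>g k\<close> at index
    \<open>s + k\<close>, both composed with \<open>q k\<close> on the blocks. There are fewer
    conditions than the \<open>3 * N\<close> unknowns.\<close>
  define F where "F l c = (if l < s then f l (c div N) * q l (c mod N)
      else g (l - s) (c div N) * q (l - s) (c mod N))" for l c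
  obtain v where v: "v \<in> carrier_vec (3 * N)" "v \<noteq> 0\<^sub>v (3 * N)"
    "\<And>l. l < 2 * s \<Longrightarrow> (\<Sum>c<3 * N. F l c * v $ c) = 0"
    using exists_common_zero[OF s, of F] by blast
  \<comment> \<open>\<open>y k b\<close> pairs \<open>q k\<close> with block \<open>b\<close> of
    \<open>v\<close>, so \<open>v\<close> enters the product with \<open>H\<close> only through
    these numbers.\<close>
  define y where "y k b = (\<Sum>j<N. q k j * v $ (b * N + j))" for k b
  have fy: "(\<Sum>b<3. f k b * y k b) = 0" if "k < s" for k
  proof -
    have "(\<Sum>b<3. f k b * y k b) = (\<Sum>b<3. \<Sum>j<N. F k (b * N + j) * v $ (b * N + j))"
      using that by (simp add: F_def y_def sum_distrib_left mult.assoc)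
    also have "\<dots> = 0"
      using v(3)[of k] that by (simp add: sum_blocks)
    finally show ?thesis .
  qed
  have gy: "(\<Sum>b<3. g k b * y k b) = 0" if "k < s" for k
  proof -
    have "(\<Sum>b<3. g k b * y k b) = (\<Sum>b<3. \<Sum>j<N. F (s + k) (b * N + j) * v $ (b * N + j))"
      by (simp add: F_def y_def sum_distrib_left mult.assoc)
    also have "\<dots> = 0"
      using v(3)[of "s + k"] that by (simp add: sum_blocks)
    finally show ?thesis .
  qed
  have Hv: "(\<Sum>j<N. H c i j * v $ (b * N + j)) = (\<Sum>k<s. q k i * (lam k c * y k b))"
    if "c < 3" "i < N" for c i b
  proof -
    have "(\<Sum>j<N. H c i j * v $ (b * N + j)) =
        (\<Sum>j<N. \<Sum>k<s. lam k c * (q k i * q k j) * v $ (b * N + j))"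
      using that by (simp add: H sum_distrib_right)
    also have "\<dots> = (\<Sum>k<s. \<Sum>j<N. lam k c * (q k i * q k j) * v $ (b * N + j))"
      by (rule sum.swap)
    also have "\<dots> = (\<Sum>k<s. q k i * (lam k c * y k b))"
      by (simp add: y_def sum_distrib_left mult_ac)
    finally show ?thesis .
  qed
  have "(koszul_mat N H *\<^sub>v v) $ k = 0" if "k < 3 * N" for k
  proof -
    have N: "N > 0" and a: "k div N < 3" and i: "k mod N < N"
      using that by (auto intro: Nat.gr0I simp: less_mult_imp_div_less)
    have "(koszul_mat N H *\<^sub>v v) $ (k div N * N + k mod N) = 0"
      \<comment> \<open>The difference vanishes term by term: by \<open>fy\<close> and
        \<open>gy\<close>, the cross product of \<open>y k\<close> with \<open>lam k\<close> is zero
        for each \<open>k\<close>.\<close>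
      by (subst koszul_mat_mult_vec[OF v(1) a i]) (simp add: Hv i fg[OF a fy gy, simplified])
    then show ?thesis
      by simp
  qed
  then have "koszul_mat N H *\<^sub>v v = 0\<^sub>v (3 * N)"
    using koszul_mat_carrier[of N H] by (intro eq_vecI) auto
  with v(1,2) show ?thesis
    using det_0_iff_vec_prod_zero[OF koszul_mat_carrier] by blast
qed

section \<open>The Koszul determinant as a form\<close>

lemma map_koszul_mat:
  assumes "comm_ring_hom h"
  shows "map_mat h (koszul_mat N H) = koszul_mat N (\<lambda>c i j. h (H c i j))"
proof -
  interpret comm_ring_hom h by fact
  show ?thesis
    by (rule eq_matI) (auto simp: koszul_mat_def hom_uminus)
qed

lemma koszul_mat_det_in_forms:
  assumes "\<And>c i j. c < 3 \<Longrightarrow> i < N \<Longrightarrow> j < N \<Longrightarrow> H c i j \<in> forms X 1"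
  shows "Determinant.det (koszul_mat N H) \<in> forms X (3 * N)"
proof -
  have "koszul_mat N H $$ (k, l) \<in> forms X 1" if "k < 3 * N" "l < 3 * N" for k l
  proof -
    have "N > 0"
      using that by (auto intro: Nat.gr0I)
    then show ?thesis
      using that by (auto simp: koszul_mat_def forms_0 simp del: One_nat_def intro!: forms_uminus assms)
  qed
  from forms_det[OF koszul_mat_carrier this] show ?thesis
    by simp
qed

section \<open>Quadratic forms and sums of squares\<close>

definition quad_monom :: "'v \<Rightarrow> 'v \<Rightarrow> 'v monom" where
  "quad_monom i j = Poly_Mapping.single i 1 + Poly_Mapping.single j 1"

lemma single_1_eq_iff: "Poly_Mapping.single i 1 = Poly_Mapping.single j (1::nat) \<longleftrightarrow> i = j"
  by (metis lookup_single_eq lookup_single_not_eq zero_neq_one)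

lemma quad_monom_commute: "quad_monom i j = quad_monom j i"
  by (simp add: quad_monom_def add.commute)

lemma quad_monom_left_cancel: "quad_monom i j = quad_monom i b \<longleftrightarrow> j = b"
  by (simp only: quad_monom_def add_left_cancel single_1_eq_iff)

lemma quad_monom_eq_iff:
  "quad_monom i j = quad_monom a b \<longleftrightarrow> i = a \<and> j = b \<or> i = b \<and> j = a"
proof
  assume *: "quad_monom i j = quad_monom a b"
  \<comment> \<open>Comparing the exponents of variable \<open>i\<close> shows that \<open>i\<close>
    occurs on the right; the other index then follows by cancellation.\<close>
  have "(if i = i then 1 else 0) + (if j = i then 1 else 0) =
      (if a = i then 1 else 0) + (if b = i then 1 else (0::nat))"
    using arg_cong[OF *, of "\<lambda>m. Poly_Mapping.lookup m i"]
    by (simp only: quad_monom_def lookup_add lookup_single when_def)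
  then have "a = i \<or> b = i"
    by (metis add_is_0 one_neq_zero)
  then show "i = a \<and> j = b \<or> i = b \<and> j = a"
  proof
    assume "a = i"
    with * show ?thesis
      by (simp add: quad_monom_left_cancel)
  next
    assume "b = i"
    with * have "quad_monom i j = quad_monom i a"
      by (simp add: quad_monom_commute)
    with \<open>b = i\<close> show ?thesis
      by (simp add: quad_monom_left_cancel)
  qed
next
  assume "i = a \<and> j = b \<or> i = b \<and> j = a"
  then show "quad_monom i j = quad_monom a b"
    by (metis quad_monom_commute)
qed

lemma quad_monom_in_monomials: "i \<in> X \<Longrightarrow> j \<in> X \<Longrightarrow> quad_monom i j \<in> monomials X 2"
  using monomials_add[OF single_in_monomials[of i X 1] single_in_monomials[of j X 1]]
  by (simp add: quad_monom_def numeral_2_eq_2)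

lemma monomials_1: "monomials X 1 = (\<lambda>x. Poly_Mapping.single x 1) ` X"
proof
  show "monomials X 1 \<subseteq> (\<lambda>x. Poly_Mapping.single x 1) ` X"
  proof
    fix m assume "m \<in> monomials X 1"
    then have m: "Poly_Mapping.keys m \<subseteq> X"
      "(\<Sum>x\<in>Poly_Mapping.keys m. Poly_Mapping.lookup m x) = 1"
      by (auto simp: monomials_def)
    then obtain x where x: "x \<in> Poly_Mapping.keys m" "Poly_Mapping.lookup m x = 1"
      "\<forall>y\<in>Poly_Mapping.keys m. x \<noteq> y \<longrightarrow> Poly_Mapping.lookup m y = 0"
      by (auto simp: sum_eq_1_iff simp del: One_nat_def)
    then have "m = Poly_Mapping.single x 1"
      by (intro poly_mapping_eqI) (auto simp: lookup_single when_def in_keys_iff)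
    with x(1) m(1) show "m \<in> (\<lambda>x. Poly_Mapping.single x 1) ` X"
      by blast
  qed
qed (auto simp: single_in_monomials)

lemma linear_form_eq_sum:
  assumes "finite X" "Q \<in> forms X 1"
  shows "Q = (\<Sum>i\<in>X. Poly_Mapping.single (Poly_Mapping.single i 1)
    (Poly_Mapping.lookup Q (Poly_Mapping.single i 1)))"
proof (rule poly_mapping_eqI)
  fix m
  show "Poly_Mapping.lookup Q m = Poly_Mapping.lookup (\<Sum>i\<in>X.
    Poly_Mapping.single (Poly_Mapping.single i 1)
      (Poly_Mapping.lookup Q (Poly_Mapping.single i 1))) m"
  proof (cases "m \<in> monomials X 1")
    case True
    then obtain x where "x \<in> X" "m = Poly_Mapping.single x 1"
      by (auto simp: monomials_1 simp del: One_nat_def)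
    with assms(1) show ?thesis
      by (simp add: Poly_Mapping.lookup_sum lookup_single when_def single_1_eq_iff del: One_nat_def)
  next
    case False
    then have "Poly_Mapping.lookup Q m = 0"
      using assms(2) by (auto simp: forms_def in_keys_iff)
    with False show ?thesis
      by (auto simp: Poly_Mapping.lookup_sum lookup_single when_def monomials_1
          simp del: One_nat_def intro!: sum.neutral)
  qed
qed

section \<open>Hessians of quadratic forms and of spans of squares\<close>

text \<open>For a quadratic form this is the matrix of second partial derivatives. The factor 2 on
  the diagonal makes the matrix of a square of a linear form have rank at most one.\<close>

definition hessian :: "'v cpoly \<Rightarrow> 'v \<Rightarrow> 'v \<Rightarrow> complex" where
  "hessian p i j = (if i = j then 2 else 1) * Poly_Mapping.lookup p (quad_monom i j)"

lemma hessian_0: "hessian 0 i j = 0"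
  by (simp add: hessian_def)

lemma hessian_add: "hessian (p + q) i j = hessian p i j + hessian q i j"
  by (simp add: hessian_def lookup_add algebra_simps)

lemma hessian_cscale: "hessian (cscale c p) i j = c * hessian p i j"
  by (simp add: hessian_def lookup_cscale)

text \<open>The coefficient of a mixed monomial in \<open>Q ^ 2\<close> is collected from two
  ordered pairs, that of a pure square from one; the factor in \<open>hessian\<close> evens this
  out.\<close>

lemma hessian_square:
  assumes "finite X" "Q \<in> forms X 1" "a \<in> X" "b \<in> X"
  shows "hessian (Q ^ 2) a b = 2 * (Poly_Mapping.lookup Q (Poly_Mapping.single a 1) *
    Poly_Mapping.lookup Q (Poly_Mapping.single b 1))"
proof -
  define q where "q i = Poly_Mapping.lookup Q (Poly_Mapping.single i 1)" for i
  have Q: "Q = (\<Sum>i\<in>X. Poly_Mapping.single (Poly_Mapping.single i 1) (q i))"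
    using linear_form_eq_sum[OF assms(1,2)] by (simp add: q_def)
  have "Q ^ 2 = (\<Sum>i\<in>X. \<Sum>j\<in>X. Poly_Mapping.single (quad_monom i j) (q i * q j))"
    by (subst (1) Q) (simp only: power2_eq_square sum_product mult_single quad_monom_def)
  then have *: "Poly_Mapping.lookup (Q ^ 2) (quad_monom a b) =
      (\<Sum>i\<in>X. \<Sum>j\<in>X. if i = a \<and> j = b \<or> i = b \<and> j = a then q i * q j else 0)"
    by (simp add: Poly_Mapping.lookup_sum lookup_single when_def quad_monom_eq_iff)
  show ?thesis
  proof (cases "a = b")
    case True
    then have "Poly_Mapping.lookup (Q ^ 2) (quad_monom a b) =
        (\<Sum>i\<in>X. if i = a then \<Sum>j\<in>X. if j = a then q i * q j else 0 else 0)"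
      unfolding * by (intro sum.cong) auto
    also have "\<dots> = q a * q a"
      using assms by simp
    finally show ?thesis
      using True by (simp add: hessian_def q_def)
  next
    case False
    then have "Poly_Mapping.lookup (Q ^ 2) (quad_monom a b) =
        (\<Sum>i\<in>X. if i = a then \<Sum>j\<in>X. if j = b then q i * q j else 0
          else if i = b then \<Sum>j\<in>X. if j = a then q i * q j else 0 else 0)"
      unfolding * by (intro sum.cong) auto
    also have "\<dots> = (\<Sum>i\<in>X. if i = a then q a * q b else if i = b then q b * q a else 0)"
      using assms by (intro sum.cong) auto
    also have "\<dots> = (\<Sum>i\<in>X. (if i = a then q a * q b else 0) + (if i = b then q b * q a else 0))"
      using False by (intro sum.cong) auto
    also have "\<dots> = 2 * (q a * q b)"
      using assms by (simp add: sum.distrib)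
    finally show ?thesis
      using False by (simp add: hessian_def q_def)
  qed
qed

text \<open>One family \<open>q\<close>, the coefficient vectors of representatives of
  \<open>M\<close>, serves all \<open>p\<close> at once. The set \<open>T\<close> of forms with such
  a Hessian is a subspace containing every square of a representative, hence the whole span.\<close>

lemma hessian_power_span:
  assumes "M \<in> U_set n 2 s"
  obtains q where "\<And>p. p \<in> power_span 2 M \<Longrightarrow>
    \<exists>lam. \<forall>i\<le>n. \<forall>j\<le>n. hessian p i j = (\<Sum>k<s. lam k * (q k i * q k j))"
proof -
  obtain Qs where M: "M = mset (map (\<lambda>Q. cpoly.span {Q}) Qs)"
    and Qs: "length Qs = s" "set Qs \<subseteq> Sym_forms n 1"
    using assms by (auto simp: U_set_def)
  define q where "q k i = Poly_Mapping.lookup (Qs ! k) (Poly_Mapping.single i 1)" for k i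
  define T where "T = {p. \<exists>lam. \<forall>i\<le>n. \<forall>j\<le>n.
    hessian p i j = (\<Sum>k<s. lam k * (q k i * q k j))}"
  have "cpoly.subspace T"
  proof (rule cpoly.subspaceI)
    show "0 \<in> T"
      unfolding T_def by (auto simp: hessian_0 intro!: exI[of _ "\<lambda>_. 0"])
  next
    fix p p' assume "p \<in> T" "p' \<in> T"
    then obtain lam lam' where
      "\<forall>i\<le>n. \<forall>j\<le>n. hessian p i j = (\<Sum>k<s. lam k * (q k i * q k j))"
      "\<forall>i\<le>n. \<forall>j\<le>n. hessian p' i j = (\<Sum>k<s. lam' k * (q k i * q k j))"
      by (auto simp: T_def)
    then show "p + p' \<in> T"
      unfolding T_def
      by (auto simp: hessian_add distrib_right sum.distrib intro!: exI[of _ "\<lambda>k. lam k + lam' k"])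
  next
    fix c p assume "p \<in> T"
    then obtain lam where "\<forall>i\<le>n. \<forall>j\<le>n. hessian p i j = (\<Sum>k<s. lam k * (q k i * q k j))"
      by (auto simp: T_def)
    then show "cscale c p \<in> T"
      unfolding T_def
      by (auto simp: hessian_cscale sum_distrib_left mult.assoc intro!: exI[of _ "\<lambda>k. c * lam k"])
  qed
  moreover have "(\<Union>l\<in>set_mset M. (\<lambda>Q. Q ^ 2) ` l) \<subseteq> T"
  proof
    fix p assume "p \<in> (\<Union>l\<in>set_mset M. (\<lambda>Q. Q ^ 2) ` l)"
    then obtain Q0 Q where Q0: "Q0 \<in> set Qs" and Q: "Q \<in> cpoly.span {Q0}" and p: "p = Q ^ 2"
      unfolding M by auto
    from Q0 obtain k where k: "k < s" "Q0 = Qs ! k"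
      using Qs(1) by (auto simp: in_set_conv_nth)
    obtain c where c: "Q = cscale c Q0"
      using Q by (auto simp: cpoly.span_singleton)
    have "Q0 \<in> forms {0..n} 1"
      using Q0 Qs(2) by (auto simp: Sym_forms_def)
    then have Q1: "Q \<in> forms {0..n} 1"
      unfolding c by (rule cpoly.subspace_scale[OF subspace_forms])
    \<comment> \<open>Rescaling the representative by \<open>c\<close> scales its square by
      \<open>c ^ 2\<close>; the 2 comes from \<open>hessian_square\<close>.\<close>
    have "hessian p i j = 2 * c ^ 2 * (q k i * q k j)" if "i \<le> n" "j \<le> n" for i j
      using hessian_square[OF _ Q1, of i j] that
      by (simp add: p c lookup_cscale q_def k power2_eq_square[of c])
    moreover have "(\<Sum>k'<s. (if k' = k then 2 * c ^ 2 else 0) * (q k' i * q k' j)) =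
        2 * c ^ 2 * (q k i * q k j)" for i j
    proof -
      have "(\<Sum>k'<s. (if k' = k then 2 * c ^ 2 else 0) * (q k' i * q k' j)) =
          (\<Sum>k'<s. if k' = k then 2 * c ^ 2 * (q k i * q k j) else 0)"
        by (intro sum.cong) auto
      with k(1) show ?thesis
        by simp
    qed
    ultimately show "p \<in> T"
      unfolding T_def by (auto intro!: exI[of _ "\<lambda>k'. if k' = k then 2 * c ^ 2 else 0"])
  qed
  ultimately have "power_span 2 M \<subseteq> T"
    unfolding power_span_def by (rule cpoly.span_minimal[rotated])
  then show ?thesis
    by (intro that[of q]) (auto simp: T_def)
qed

section \<open>The equation of \<open>\<Sigma>\<close>\<close>

text \<open>By Cramer's rule, replacing the \<open>c\<close>-th of the three columns \<open>ms\<close> by a variable column turns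
  the Pluecker coordinates into the coefficients of an element of \<open>L\<close>; for \<open>L\<close> in the affine
  chart \<open>ms\<close>, these elements form the reduced echelon basis.\<close>

definition koszul_form :: "nat \<Rightarrow> nat monom list \<Rightarrow> nat monom list cpoly" where
  "koszul_form n ms = Determinant.det (koszul_mat (Suc n) (\<lambda>c i j.
    Poly_Mapping.single (Poly_Mapping.single (ms[c := quad_monom i j]) 1) (if i = j then 2 else 1)))"

text \<open>Replacing an entry of \<open>ms\<close> by a quadratic monomial gives another Pluecker
  variable, so the matrix entries are linear forms.\<close>

lemma koszul_form_in_forms:
  assumes "ms \<in> pluecker_vars n 2 3"
  shows "koszul_form n ms \<in> forms (pluecker_vars n 2 3) (3 * Suc n)"
proof -
  have "ms[c := quad_monom i j] \<in> pluecker_vars n 2 3" if "i < Suc n" "j < Suc n" for c i j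
    using assms that quad_monom_in_monomials[of i "{0..n}" j] set_update_subset_insert[of ms c]
    by (fastforce simp: pluecker_vars_def)
  then show ?thesis
    unfolding koszul_form_def
    by (intro koszul_mat_det_in_forms forms_single single_in_monomials)
qed

lemma poly_eval_koszul_form:
  "poly_eval (pluecker B) (koszul_form n ms) = Determinant.det (koszul_mat (Suc n)
    (\<lambda>c i j. (if i = j then 2 else 1) * pluecker B (ms[c := quad_monom i j])))"
proof -
  interpret comm_ring_hom "poly_eval (pluecker B)"
    by (rule comm_ring_hom_poly_eval)
  show ?thesis
    unfolding koszul_form_def hom_det[symmetric] map_koszul_mat[OF comm_ring_hom_axioms]
    by (simp add: poly_eval_single monom_eval_def)
qed

text \<open>For each column \<open>c\<close> the modified Pluecker coordinates are the coefficients
  of an element of \<open>L\<close>. Its Hessian is a combination of the same \<open>s\<close> rank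
  one matrices, so \<open>det_koszul_mat_eq_0\<close> applies to the three slices.\<close>

lemma Sigma_set_vanishing_koszul_form:
  assumes "2 * s < 3 * Suc n" "length ms = 3" "L \<in> Sigma_set n 2 3 s"
  shows "L \<notin> nonvanishing_locus n 2 3 (koszul_form n ms)"
proof
  assume "L \<in> nonvanishing_locus n 2 3 (koszul_form n ms)"
  then obtain B where B: "basis_list L B" "poly_eval (pluecker B) (koszul_form n ms) \<noteq> 0"
    by (auto simp: nonvanishing_locus_def)
  obtain M where M: "M \<in> U_set n 2 s" "L \<subseteq> power_span 2 M" and L: "L \<in> Grass 3 (Sym_forms n 2)"
    using assms(3) by (auto simp: Sigma_set_def)
  have len: "length B = 3"
    using L length_basis_list[OF B(1)] by (simp add: Grass_def)
  obtain q where q: "\<And>p. p \<in> power_span 2 M \<Longrightarrow>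
    \<exists>lam. \<forall>i\<le>n. \<forall>j\<le>n. hessian p i j = (\<Sum>k<s. lam k * (q k i * q k j))"
    using hessian_power_span[OF M(1)] by blast
  have "\<exists>lam. \<forall>i\<le>n. \<forall>j\<le>n. (if i = j then 2 else 1) * pluecker B (ms[c := quad_monom i j]) =
    (\<Sum>k<s. lam k * (q k i * q k j))" if c: "c < 3" for c
  proof -
    obtain p where p: "p \<in> cpoly.span (set B)"
      and lookup_p: "\<And>m. pluecker B (ms[c := m]) = Poly_Mapping.lookup p m"
      by (rule pluecker_update_in_span[of c B ms]) (use c len assms(2) in auto)
    have "p \<in> power_span 2 M"
      using p B(1) M(2) by (auto simp: basis_list_def)
    from q[OF this] show ?thesis
      by (simp only: hessian_def lookup_p)
  qed
  then obtain lam where "\<And>c i j. c < 3 \<Longrightarrow> i \<le> n \<Longrightarrow> j \<le> n \<Longrightarrow>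
      (if i = j then 2 else 1) * pluecker B (ms[c := quad_monom i j]) =
      (\<Sum>k<s. lam c k * (q k i * q k j))"
    by metis
  then have "poly_eval (pluecker B) (koszul_form n ms) = 0"
    unfolding poly_eval_koszul_form
    by (intro det_koszul_mat_eq_0[OF assms(1), where lam = "\<lambda>k c. lam c k" and q = q]) simp
  with B(2) show False ..
qed

text \<open>For odd \<open>n\<close>, a net on which the equation does not vanish: the direct sum of the nets
  \<open>\<langle>x\<^sup>2, y\<^sup>2, x y\<rangle>\<close> in the pairs of variables \<open>x\<^sub>0, x\<^sub>1\<close>; \<open>x\<^sub>2, x\<^sub>3\<close>; \<open>\<dots>\<close>\<close>

definition diagonal_net :: "nat \<Rightarrow> nat cpoly list" where
  "diagonal_net n =
    [\<Sum>i | i \<le> n \<and> even i. Poly_Mapping.single (quad_monom i i) 1,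
     \<Sum>i | i \<le> n \<and> odd i. Poly_Mapping.single (quad_monom i i) 1,
     \<Sum>i | i \<le> n \<and> even i. Poly_Mapping.single (quad_monom i (Suc i)) 1]"

lemma length_diagonal_net: "length (diagonal_net n) = 3"
  by (simp add: diagonal_net_def)

text \<open>Columns in which \<open>diagonal_net n\<close> is in reduced echelon form when
  \<open>n\<close> is at least 1.\<close>

definition diagonal_pivots :: "nat monom list" where
  "diagonal_pivots = [quad_monom 0 0, quad_monom 1 1, quad_monom 0 1]"

text \<open>The involution exchanging \<open>2 * k\<close> and \<open>2 * k + 1\<close>, which pairs
  up the variables.\<close>

definition partner :: "nat \<Rightarrow> nat" where
  "partner i = (if even i then Suc i else i - 1)"

lemma partner_neq [simp]: "partner i \<noteq> i" "i \<noteq> partner i"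
  by (cases i; simp add: partner_def)+

lemma partner_partner [simp]: "partner (partner i) = i"
  by (auto simp: partner_def)

lemma even_partner [simp]: "even (partner i) \<longleftrightarrow> odd i"
  by (auto simp: partner_def)

text \<open>For odd \<open>n\<close> the indices from 0 to \<open>n\<close> split into complete
  pairs.\<close>

lemma partner_le: "odd n \<Longrightarrow> i \<le> n \<Longrightarrow> partner i \<le> n"
  by (auto simp: partner_def) (metis Suc_leI le_neq_implies_less)

lemma lookup_sum_single:
  assumes "finite I"
  shows "Poly_Mapping.lookup (\<Sum>i\<in>I. Poly_Mapping.single (f i) 1) m =
    of_nat (card {i \<in> I. f i = m})"
  using assms by (simp add: Poly_Mapping.lookup_sum lookup_single when_def sum.If_cases Int_def)

lemma lookup_diagonal_net:
  assumes "a \<le> n" "b \<le> n"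
  shows "Poly_Mapping.lookup (diagonal_net n ! 0) (quad_monom a b) = (if a = b \<and> even a then 1 else 0)"
    and "Poly_Mapping.lookup (diagonal_net n ! 1) (quad_monom a b) = (if a = b \<and> odd a then 1 else 0)"
    and "Poly_Mapping.lookup (diagonal_net n ! 2) (quad_monom a b) = (if b = partner a then 1 else 0)"
proof -
  \<comment> \<open>The shape of these sets is what \<open>quad_monom_eq_iff\<close> produces. In
    the third, the even index of a pair is the smaller one, hence \<open>min a b\<close>.\<close>
  have E: "{i. i \<le> n \<and> even i \<and> (i = a \<and> i = b \<or> i = b \<and> i = a)} =
      (if a = b \<and> even a then {a} else {})"
    "{i. i \<le> n \<and> odd i \<and> (i = a \<and> i = b \<or> i = b \<and> i = a)} =
      (if a = b \<and> odd a then {a} else {})"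
    "{i. i \<le> n \<and> even i \<and> (i = a \<and> Suc i = b \<or> i = b \<and> Suc i = a)} =
      (if b = partner a then {min a b} else {})"
    using assms by (auto simp: partner_def)
  show "Poly_Mapping.lookup (diagonal_net n ! 0) (quad_monom a b) = (if a = b \<and> even a then 1 else 0)"
    by (auto simp: diagonal_net_def lookup_sum_single quad_monom_eq_iff E)
  show "Poly_Mapping.lookup (diagonal_net n ! 1) (quad_monom a b) = (if a = b \<and> odd a then 1 else 0)"
    by (auto simp: diagonal_net_def lookup_sum_single quad_monom_eq_iff E)
  show "Poly_Mapping.lookup (diagonal_net n ! 2) (quad_monom a b) = (if b = partner a then 1 else 0)"
    by (auto simp: diagonal_net_def lookup_sum_single quad_monom_eq_iff E)
qed

lemma pluecker_diagonal_net:
  assumes "n \<ge> 1" "c < 3"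
  shows "pluecker (diagonal_net n) (diagonal_pivots[c := m]) =
    Poly_Mapping.lookup (diagonal_net n ! c) m"
proof (rule pluecker_update_echelon)
  fix i j assume "i < length (diagonal_net n)" "j < length (diagonal_net n)"
  then have "i < 3" "j < 3"
    by (simp_all add: length_diagonal_net)
  then show "Poly_Mapping.lookup (diagonal_net n ! i) (diagonal_pivots ! j) =
      (if i = j then 1 else 0)"
    using assms(1)
    by (auto dest!: less_3_cases simp: diagonal_pivots_def partner_def
        lookup_diagonal_net simp flip: One_nat_def)
qed (use assms(2) in \<open>simp_all add: length_diagonal_net diagonal_pivots_def\<close>)

text \<open>The hypotheses on \<open>H\<close> describe the Hessians of the three members of
  \<open>diagonal_net n\<close>. The kernel equations split along the pairs of variables and force
  every block of a kernel vector to vanish.\<close>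

lemma det_koszul_mat_diagonal_net:
  fixes H :: "nat \<Rightarrow> nat \<Rightarrow> nat \<Rightarrow> complex"
  assumes n: "odd n"
    and H: "\<And>i j. i \<le> n \<Longrightarrow> j \<le> n \<Longrightarrow> H 0 i j = (if j = i then if even i then 2 else 0 else 0)"
      "\<And>i j. i \<le> n \<Longrightarrow> j \<le> n \<Longrightarrow> H 1 i j = (if j = i then if odd i then 2 else 0 else 0)"
      "\<And>i j. i \<le> n \<Longrightarrow> j \<le> n \<Longrightarrow> H 2 i j = (if j = partner i then 1 else 0)"
  shows "Determinant.det (koszul_mat (Suc n) H) \<noteq> 0"
proof
  let ?N = "Suc n"
  assume "Determinant.det (koszul_mat ?N H) = 0"
  then obtain v where v: "v \<in> carrier_vec (3 * ?N)" "v \<noteq> 0\<^sub>v (3 * ?N)"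
    "koszul_mat ?N H *\<^sub>v v = 0\<^sub>v (3 * ?N)"
    using det_0_iff_vec_prod_zero[OF koszul_mat_carrier] by blast
  define y where "y b j = v $ (b * ?N + j)" for b j
  have S: "(\<Sum>j<?N. H 0 i j * y b j) = (if even i then 2 * y b i else 0)"
    "(\<Sum>j<?N. H 1 i j * y b j) = (if odd i then 2 * y b i else 0)"
    "(\<Sum>j<?N. H 2 i j * y b j) = y b (partner i)" if "i \<le> n" for i b
  proof -
    have "(\<Sum>j<?N. H 0 i j * y b j) = (\<Sum>j<?N. if j = i then if even i then 2 * y b i else 0 else 0)"
      using that by (intro sum.cong) (auto simp: H)
    with that show "(\<Sum>j<?N. H 0 i j * y b j) = (if even i then 2 * y b i else 0)"
      by simp
    have "(\<Sum>j<?N. H 1 i j * y b j) = (\<Sum>j<?N. if j = i then if odd i then 2 * y b i else 0 else 0)"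
      using that by (intro sum.cong) (auto simp: H simp del: One_nat_def)
    with that show "(\<Sum>j<?N. H 1 i j * y b j) = (if odd i then 2 * y b i else 0)"
      by simp
    have "(\<Sum>j<?N. H 2 i j * y b j) = (\<Sum>j<?N. if j = partner i then y b j else 0)"
      using that by (intro sum.cong) (auto simp: H)
    with that partner_le[OF n that] show "(\<Sum>j<?N. H 2 i j * y b j) = y b (partner i)"
      by simp
  qed
  \<comment> \<open>A kernel vector has zero cross product with \<open>H\<close>; the cases
    \<open>a = 0, 1, 2\<close> give \<open>e0\<close>, \<open>e1\<close>, \<open>e2\<close>.\<close>
  have eq: "(\<Sum>j<?N. H ((a + 2) mod 3) i j * y ((a + 1) mod 3) j) =
      (\<Sum>j<?N. H ((a + 1) mod 3) i j * y ((a + 2) mod 3) j)" if "a < 3" "i \<le> n" for a i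
    using koszul_mat_mult_vec[OF v(1) that(1), of i H] block_index_less[of a i ?N] that v(3)
    by (simp add: y_def del: sum.lessThan_Suc)
  have e0: "y 1 (partner i) = (if odd i then 2 * y 2 i else 0)" if "i \<le> n" for i
    using eq[of 0 i] that S by (simp add: numeral_2_eq_2[symmetric] del: sum.lessThan_Suc)
  have e1: "(if even i then 2 * y 2 i else 0) = y 0 (partner i)" if "i \<le> n" for i
    using eq[of 1 i] that S by (simp add: numeral_2_eq_2[symmetric] del: sum.lessThan_Suc)
  have e2: "(if odd i then 2 * y 0 i else 0) = (if even i then 2 * y 1 i else 0)" if "i \<le> n" for i
    using eq[of 2 i] that S by (simp add: numeral_2_eq_2[symmetric] del: sum.lessThan_Suc)
  \<comment> \<open>\<open>e2\<close> kills \<open>y 0\<close> at odd and \<open>y 1\<close> at even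
    indices. \<open>e1\<close> and \<open>e0\<close>, read at the partner, kill the remaining
    entries, and then they give \<open>y 2\<close>.\<close>
  have y0: "y 0 i = 0" if "i \<le> n" for i
    using e1[OF partner_le[OF n that]] e2[OF that] by (cases "even i") auto
  have y1: "y 1 i = 0" if "i \<le> n" for i
    using e0[OF partner_le[OF n that]] e2[OF that] by (cases "even i") auto
  have y2: "y 2 i = 0" if "i \<le> n" for i
    using e0[OF that] e1[OF that] y0[OF partner_le[OF n that]] y1[OF partner_le[OF n that]]
    by (cases "even i") auto
  have "v $ k = 0" if "k < 3 * ?N" for k
  proof -
    have "k div ?N < 3" "k mod ?N \<le> n"
      using that by (auto simp: less_mult_imp_div_less less_Suc_eq_le[symmetric] simp del: mult_Suc mult_Suc_right)
    then have "y (k div ?N) (k mod ?N) = 0"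
      using less_3_cases[of "k div ?N"] y0 y1 y2 by metis
    then show ?thesis
      by (simp add: y_def del: mult_Suc mult_Suc_right)
  qed
  with v(1,2) show False
    by (metis carrier_vecD eq_vecI index_zero_vec)
qed

lemma diagonal_net_nonvanishing:
  assumes "odd n"
  shows "cpoly.span (set (diagonal_net n)) \<in>
    nonvanishing_locus n 2 3 (koszul_form n diagonal_pivots)"
proof -
  have n: "n \<ge> 1"
    using odd_pos[OF assms] by simp
  have P: "pluecker (diagonal_net n) (diagonal_pivots[c := quad_monom i j]) =
      Poly_Mapping.lookup (diagonal_net n ! c) (quad_monom i j)" if "c < 3" for c i j
    using pluecker_diagonal_net[OF n that] .
  have ne: "poly_eval (pluecker (diagonal_net n)) (koszul_form n diagonal_pivots) \<noteq> 0"
    unfolding poly_eval_koszul_form using assms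
    by (rule det_koszul_mat_diagonal_net)
      (use n in \<open>auto simp: P lookup_diagonal_net simp del: One_nat_def\<close>)
  \<comment> \<open>Replacing the first pivot by itself shows that the pivot minor is 1, which gives
    independence.\<close>
  have "pluecker (diagonal_net n) (diagonal_pivots[0 := quad_monom 0 0]) = 1"
    using lookup_diagonal_net(1)[of 0 n 0] by (simp add: P)
  then have indep: "lin_indep_list (diagonal_net n)"
    by (intro pluecker_nonzero_lin_indep[of _ "diagonal_pivots[0 := quad_monom 0 0]"]) simp
  have "set (diagonal_net n) \<subseteq> Sym_forms n 2"
    unfolding diagonal_net_def Sym_forms_def
    using assms by (auto intro!: forms_sum forms_single quad_monom_in_monomials)
      (metis Suc_leI le_neq_implies_less)
  then have "cpoly.span (set (diagonal_net n)) \<in> Grass 3 (Sym_forms n 2)"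
    using span_in_Grass[OF indep, of "Sym_forms n 2"] length_diagonal_net[of n]
    by (simp add: Sym_forms_def subspace_forms)
  with ne basis_list_span[OF indep] show ?thesis
    by (auto simp: nonvanishing_locus_def)
qed

text \<open>The nonvanishing locus of the Koszul form is open, misses
  \<open>Sigma_set n 2 3 s\<close> and contains the explicit net. That net is therefore outside the
  closure, and irreducibility of the Grassmannian gives the codimension bound.\<close>

lemma codim_Sigma_set_nets_of_quadrics:
  assumes "odd n" "2 * s < 3 * Suc n"
  shows "codim (zariski_Grass n 2 3) (Sigma_set n 2 3 s) \<ge> 1"
proof (rule codim_ge_1)
  let ?X = "zariski_Grass n 2 3"
  let ?F = "koszul_form n diagonal_pivots"
  let ?L = "cpoly.span (set (diagonal_net n))"
  have "diagonal_pivots \<in> pluecker_vars n 2 3"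
    using assms(1) odd_pos[of n] by (auto simp: diagonal_pivots_def pluecker_vars_def
        intro!: quad_monom_in_monomials)
  then have op: "openin ?X (nonvanishing_locus n 2 3 ?F)"
    by (rule openin_zariski_Grass_nonvanishing_locus[OF koszul_form_in_forms])
  have L: "?L \<in> nonvanishing_locus n 2 3 ?F"
    by (rule diagonal_net_nonvanishing[OF assms(1)])
  have "length diagonal_pivots = 3"
    by (simp add: diagonal_pivots_def)
  with op L Sigma_set_vanishing_koszul_form[OF assms(2)]
  have "?L \<notin> Abstract_Topology.closure_of ?X (Sigma_set n 2 3 s)"
    by (auto simp: in_closure_of)
  moreover have "?L \<in> topspace ?X"
    using op L openin_subset by blast
  ultimately show "Abstract_Topology.closure_of ?X (Sigma_set n 2 3 s) \<noteq> topspace ?X"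
    by blast
  show "irreducible_closed ?X (topspace ?X)"
    using \<open>?L \<in> topspace ?X\<close> by (intro irreducible_closed_topspace_zariski_Grass) blast
qed

theorem theorem4p8:
  shows "codim (zariski_Grass 5 2 3) (Sigma_set 5 2 3 8) \<ge> 1
    \<and> N1 5 3 8 = 55 \<and> N2 5 2 3 = 54"
proof (intro conjI)
  show "codim (zariski_Grass 5 2 3) (Sigma_set 5 2 3 8) \<ge> 1"
    by (rule codim_Sigma_set_nets_of_quadrics) auto
  \<comment> \<open>As \<open>N1\<close> exceeds \<open>N2\<close>, counting parameters alone would
    not exclude that \<open>Sigma_set 5 2 3 8\<close> is dense.\<close>
  show "N1 5 3 8 = 55"
    by (simp add: N1_def)
  show "N2 5 2 3 = 54"
    by (simp add: N2_def choose_two)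
qed

end
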